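(* Let $P_n$ be a finite projective plane of order $n$ with point set $P$ and line set $L$, let $a,b$ be positive integers, and fix $S\subset P$ with $\ln n\le |\ell\cap S|\le 11\ln n$ for every $\ell\in L$. Suppose $\mathsf d=\mathsf d(n,a,b)$ is the number of colors needed for the existence of a partial coloring $f:P\setminus S\to\{1,\dots,\mathsf d\}$ in which no point of $P$ belongs to more than $a\cdot b$ dangerous pairs. Then there exists a legitimate coloring of $P_n$ with $$\max\left(\mathsf d(n,a,b),\ \left\lceil \min_{m}\ \frac{m}{m-1}\bigl(m!\,a\,b\,(m-1)\bigr)^{1/m}\right\rceil\right)$$ colors, where the minimum is over integers $m\ge 2$.
   Context: A finite projective plane of order $n$ has $n^2+n+1$ points and $n^2+n+1$ lines, each line (viewed as a set of points) has $n+1$ points and each point lies on $n+1$ lines. For a coloring $g$ of a set of points $P'\subset P$ with colors $\{1,\dots,c\}$, the type of a line $\ell$ is the vector $t_{\ell,g}=(|\ell\cap g^{-1}(1)|,\dots,|\ell\cap g^{-1}(c)|)$. A coloring $g:P\to\{1,\dots,c\}$ is legitimate if distinct lines have distinct types. For a partial coloring $f:P\setminus S\to\{1,\dots,\mathsf d\}$, a pair $\{\ell,\ell'\}$ of distinct lines is dangerous (with respect to $f$) if $d_1(t_{\ell,f},t_{\ell',f})\le 22\ln n$, where $d_1(x,y)=\sum_i|x_i-y_i|$. A point belongs to the pair $\{\ell,\ell'\}$ if it lies on $\ell\cup\ell'$. *)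

theory Defs
  imports "HOL-Analysis.Analysis"
begin

text \<open>
  Lines are sets of points.  The total numbers of points and lines and the number of lines
  through a point follow from these axioms, as does \<open>n \<ge> 2\<close>.
\<close>

locale projective_plane =
  fixes P :: "'p set" and L :: "'p set set" and n :: nat
  assumes finite_points: "finite P"
    and lines_subset: "l \<in> L \<Longrightarrow> l \<subseteq> P"
    and unique_line: "\<lbrakk>p \<in> P; q \<in> P; p \<noteq> q\<rbrakk> \<Longrightarrow> \<exists>!l. l \<in> L \<and> p \<in> l \<and> q \<in> l"
    and unique_point: "\<lbrakk>l \<in> L; l' \<in> L; l \<noteq> l'\<rbrakk> \<Longrightarrow> \<exists>!p. p \<in> l \<and> p \<in> l'"
    and quadrangle: "\<exists>Q\<subseteq>P. card Q = 4 \<and> (\<forall>l\<in>L. card (l \<inter> Q) \<le> 2)"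
    and card_line: "l \<in> L \<Longrightarrow> card l = n + 1"

text \<open>
  A coloring of a set \<open>Q\<close> of points with colors \<open>{1..c}\<close> is a function in \<open>Q \<rightarrow> {1..c}\<close>; only its
  values on \<open>Q\<close> matter.  A vector indexed by the colors is a function that is \<open>undefined\<close> outside
  \<open>{1..c}\<close>.
\<close>

definition line_type :: "nat \<Rightarrow> 'p set \<Rightarrow> ('p \<Rightarrow> nat) \<Rightarrow> 'p set \<Rightarrow> nat \<Rightarrow> nat" where
  "line_type c Q g l = (\<lambda>i\<in>{1..c}. card {p \<in> l \<inter> Q. g p = i})"

definition l1_dist :: "nat \<Rightarrow> (nat \<Rightarrow> nat) \<Rightarrow> (nat \<Rightarrow> nat) \<Rightarrow> int" where
  "l1_dist c x y = (\<Sum>i\<in>{1..c}. \<bar>int (x i) - int (y i)\<bar>)"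

definition legitimate_coloring :: "'p set \<Rightarrow> 'p set set \<Rightarrow> nat \<Rightarrow> ('p \<Rightarrow> nat) \<Rightarrow> bool" where
  "legitimate_coloring P L c g \<longleftrightarrow> g \<in> P \<rightarrow> {1..c} \<and>
     (\<forall>l\<in>L. \<forall>l'\<in>L. l \<noteq> l' \<longrightarrow> line_type c P g l \<noteq> line_type c P g l')"

definition dangerous_pairs ::
  "'p set \<Rightarrow> 'p set set \<Rightarrow> nat \<Rightarrow> 'p set \<Rightarrow> nat \<Rightarrow> ('p \<Rightarrow> nat) \<Rightarrow> 'p set set set" where
  "dangerous_pairs P L n S c f = {{l, l'} | l l'. l \<in> L \<and> l' \<in> L \<and> l \<noteq> l' \<and>
     real_of_int (l1_dist c (line_type c (P - S) f l) (line_type c (P - S) f l')) \<le> 22 * ln (real n)}"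

definition good_partial_coloring ::
  "'p set \<Rightarrow> 'p set set \<Rightarrow> nat \<Rightarrow> 'p set \<Rightarrow> nat \<Rightarrow> nat \<Rightarrow> nat \<Rightarrow> ('p \<Rightarrow> nat) \<Rightarrow> bool" where
  "good_partial_coloring P L n S a b c f \<longleftrightarrow> f \<in> P - S \<rightarrow> {1..c} \<and>
     (\<forall>p\<in>P. card {D \<in> dangerous_pairs P L n S c f. p \<in> \<Union>D} \<le> a * b)"

text \<open>
  A relation rather than a \<open>LEAST\<close> term: for some \<open>S\<close>, \<open>a\<close>, \<open>b\<close> no number of colors suffices.
\<close>

definition is_number_of_colors_needed ::
  "'p set \<Rightarrow> 'p set set \<Rightarrow> nat \<Rightarrow> 'p set \<Rightarrow> nat \<Rightarrow> nat \<Rightarrow> nat \<Rightarrow> bool" where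
  "is_number_of_colors_needed P L n S a b d \<longleftrightarrow>
     (\<exists>f. good_partial_coloring P L n S a b d f) \<and>
     (\<forall>c. (\<exists>f. good_partial_coloring P L n S a b c f) \<longrightarrow> d \<le> c)"

definition color_bound :: "nat \<Rightarrow> nat \<Rightarrow> nat \<Rightarrow> real" where
  "color_bound a b m =
     real m / (real m - 1) * root m (fact m * real a * real b * (real m - 1))"

text \<open>The infimum of \<open>color_bound a b\<close> over \<open>m \<ge> 2\<close> is a minimum.\<close>

lemma color_bound_attains_minimum:
  assumes "a > 0" and "b > 0"
  shows "\<exists>m\<ge>2. color_bound a b m = (INF k\<in>{2..}. color_bound a b k) \<and>
    (\<forall>k\<ge>2. color_bound a b m \<le> color_bound a b k)"
proof -
  define B where "B = color_bound a b 2"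
  have B: "0 \<le> B" by (simp add: B_def color_bound_def)
  have ab: "real a * real b \<ge> 1"
    using assms by (metis One_nat_def Suc_leI nat_0_less_mult_iff of_nat_1 of_nat_le_iff of_nat_mult)
  have lower: "root m (fact m) \<le> color_bound a b m" if "m \<ge> 2" for m
  proof -
    have "1 * 1 \<le> (real a * real b) * (real m - 1)"
      using that ab by (intro mult_mono) auto
    then have "fact m * 1 \<le> fact m * ((real a * real b) * (real m - 1))"
      by (intro mult_left_mono) auto
    then have r: "root m (fact m) \<le> root m (fact m * real a * real b * (real m - 1))"
      using that by (simp add: mult.assoc)
    have "1 \<le> real m / (real m - 1)" using that by simp
    then have "1 * root m (fact m) \<le>
        real m / (real m - 1) * root m (fact m * real a * real b * (real m - 1))"
      using r that by (intro mult_mono) auto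
    then show ?thesis by (simp add: color_bound_def)
  qed
  have "(\<lambda>m. inverse (fact m) * B ^ m) \<longlonglongrightarrow> 0"
    by (rule summable_LIMSEQ_zero[OF summable_exp])
  then have "\<forall>\<^sub>F m in sequentially. inverse (fact m) * B ^ m < 1"
    by (rule order_tendstoD) simp
  then obtain M where M: "\<And>m. m \<ge> M \<Longrightarrow> inverse (fact m) * B ^ m < 1"
    unfolding eventually_sequentially by blast
  have large: "B \<le> color_bound a b m" if "m \<ge> M" "m \<ge> 2" for m
  proof -
    have "B ^ m \<le> fact m"
      using M[OF that(1)] by (simp add: field_simps)
    then have "root m (B ^ m) \<le> root m (fact m)" using that by simp
    then have "B \<le> root m (fact m)" using that B by (simp add: real_root_power_cancel)
    then show ?thesis using lower[OF that(2)] by linarith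
  qed
  obtain m where m: "m \<in> {2..max 2 M}"
    "\<And>k. k \<in> {2..max 2 M} \<Longrightarrow> color_bound a b m \<le> color_bound a b k"
    using ex_min_if_finite[of "color_bound a b ` {2..max 2 M}"] by (force simp: not_less)
  have least: "color_bound a b m \<le> color_bound a b k" if "k \<ge> 2" for k
    using m(2)[of k] m(2)[of 2] large[of k] that by (cases "k \<le> M") (auto simp: B_def)
  have "(INF k\<in>{2..}. color_bound a b k) = color_bound a b m"
    using m(1) least by (intro cInf_eq_minimum) auto
  then show ?thesis using m(1) least by auto
qed

end

theory Submission
  imports Defs
begin

text \<open>
  Let \<open>m\<close> minimize the bound and \<open>\<beta>\<close> be the root occurring in it, so that the bound equals
  \<open>\<beta> + a b m! / \<beta> ^ (m - 1)\<close>.  Rosenfeld's counting method colors \<open>S\<close> point by point: if the lines of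
  a dangerous pair get equal types, then the colors of any \<open>m\<close> points on one of them are determined up
  to order by the remaining colors.  Pairs that are not dangerous stay distinguished because \<open>S\<close>
  contributes at most \<open>22 ln n\<close> to their distance.

  This needs \<open>m\<close> points of \<open>S\<close> on each line minus another one, whereas only about \<open>ln n\<close> are
  guaranteed.  If \<open>m\<close> is too large for that, minimality gives \<open>\<beta> \<ge> m\<close>, hence more than \<open>m + 1\<close> colors,
  and for \<open>n \<ge> 1102\<close> a union bound over all pairs of lines shows that already ten colors suffice.
  For \<open>n \<le> 39\<close> every pair is dangerous, so the counting method applies to all of \<open>P\<close>, or else the
  number of colors exceeds \<open>n + 2\<close> and the union bound applies.  For the orders in between, the
  distance of two types has mean square at most about \<open>2 d n\<close> over all pairs of lines, so few colors
  make most pairs dangerous; this forces \<open>a b\<close> and thereby the number of colors to be so large that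
  the union bound applies.
\<close>

section \<open>Colorings with prescribed color counts\<close>

text \<open>The set is empty unless the \<open>t i\<close> sum to \<open>card A\<close>; otherwise
  its size is a multinomial coefficient. The product form avoids division, and the induction splits
  by the color of the new point.\<close>

lemma card_colorings_with_counts:
  assumes "finite A" and "finite B"
  shows "card {u \<in> A \<rightarrow>\<^sub>E B. \<forall>i\<in>B. card {p\<in>A. u p = i} = t i} * (\<Prod>i\<in>B. fact (t i)) \<le> fact (card A)"
    (is "card (?U A t) * _ \<le> _")
  using assms(1)
proof (induction A arbitrary: t rule: finite_induct)
  case empty
  have "?U {} t \<subseteq> {\<lambda>x. undefined}" by auto
  then have "card (?U {} t) \<le> 1" using card_mono[of "{\<lambda>x. undefined}" "?U {} t"] by simp
  moreover have "card (?U {} t) = 0 \<or> (\<Prod>i\<in>B. fact (t i)) = (1::nat)"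
  proof (cases "\<forall>i\<in>B. t i = 0")
    case True
    then show ?thesis by (simp add: prod.neutral)
  next
    case False
    then have "?U {} t = {}" by auto
    then show ?thesis by (metis card.empty)
  qed
  ultimately show ?case by (elim disjE) (simp_all del: PiE_empty_domain)
next
  case (insert x A)
  let ?B = "{i\<in>B. t i > 0}"
  let ?s = "\<lambda>i. t(i := t i - 1)"
  have split: "?U (insert x A) t \<subseteq> (\<Union>i\<in>?B. (\<lambda>u. u(x := i)) ` ?U A (?s i))"
  proof
    fix u assume u: "u \<in> ?U (insert x A) t"
    have ux: "u x \<in> B" using u by auto
    have cnt: "card {p\<in>insert x A. u p = i} = card {p\<in>A. u p = i} + (if i = u x then 1 else 0)" for i
    proof (cases "i = u x")
      case True
      then have "{p\<in>insert x A. u p = i} = insert x {p\<in>A. u p = i}" by auto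
      then show ?thesis using insert True by simp
    next
      case False
      then have "{p\<in>insert x A. u p = i} = {p\<in>A. u p = i}" by auto
      then show ?thesis using False by simp
    qed
    have t: "t i = card {p\<in>A. u p = i} + (if i = u x then 1 else 0)" if "i \<in> B" for i
      using u cnt that by auto
    let ?u = "u(x := undefined)"
    have "?u \<in> A \<rightarrow>\<^sub>E B" using u insert(2) by (auto simp: PiE_iff extensional_def)
    moreover have "card {p\<in>A. ?u p = i} = (?s (u x)) i" if "i \<in> B" for i
    proof -
      have "{p\<in>A. ?u p = i} = {p\<in>A. u p = i}" using insert(2) by auto
      then show ?thesis using t[OF that] by auto
    qed
    ultimately have "?u \<in> ?U A (?s (u x))" by blast
    moreover have "u = ?u(x := u x)" by simp
    moreover have "u x \<in> ?B" using t[OF ux] ux by simp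
    ultimately show "u \<in> (\<Union>i\<in>?B. (\<lambda>u. u(x := i)) ` ?U A (?s i))" by blast
  qed
  have finU: "finite (?U A s)" for s
    using finite_PiE[OF insert(1), of "\<lambda>_. B"] assms(2) by simp
  have le: "card (?U (insert x A) t) \<le> (\<Sum>i\<in>?B. card (?U A (?s i)))"
  proof -
    have "card (?U (insert x A) t) \<le> card (\<Union>i\<in>?B. (\<lambda>u. u(x := i)) ` ?U A (?s i))"
      using split assms(2) finU by (intro card_mono) auto
    also have "\<dots> \<le> (\<Sum>i\<in>?B. card ((\<lambda>u. u(x := i)) ` ?U A (?s i)))"
      using assms(2) by (intro card_UN_le) auto
    also have "\<dots> \<le> (\<Sum>i\<in>?B. card (?U A (?s i)))"
      using finU by (intro sum_mono card_image_le) 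
    finally show ?thesis .
  qed
  have prod: "(\<Prod>j\<in>B. fact (t j)) = t i * (\<Prod>j\<in>B. fact (?s i j) :: nat)" if "i \<in> ?B" for i
  proof -
    have "(\<Prod>j\<in>B. fact (t j)) = fact (t i) * (\<Prod>j\<in>B-{i}. fact (t j) :: nat)"
      using that assms(2) by (intro prod.remove) auto
    also have "(\<Prod>j\<in>B-{i}. fact (t j) :: nat) = (\<Prod>j\<in>B-{i}. fact (?s i j))"
      by (intro prod.cong) auto
    also have "fact (t i) = t i * fact (?s i i)"
      using that fact_reduce[of "t i", where ?'a = nat] by simp
    also have "t i * fact (?s i i) * (\<Prod>j\<in>B-{i}. fact (?s i j)) =
        t i * (fact (?s i i) * (\<Prod>j\<in>B-{i}. fact (?s i j)))" by (rule mult.assoc)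
    also have "fact (?s i i) * (\<Prod>j\<in>B-{i}. fact (?s i j)) = (\<Prod>j\<in>B. fact (?s i j) :: nat)"
      using that assms(2) by (intro prod.remove[symmetric]) auto
    finally show ?thesis .
  qed
  show ?case
  proof (cases "?U (insert x A) t = {}")
    case True
    then show ?thesis unfolding True by simp
  next
    case False
    then obtain u where u: "u \<in> ?U (insert x A) t" by blast
    \<comment> \<open>Nonemptiness makes the counts add up to \<open>card A + 1\<close>, the factor
      by which the factorial grows.\<close>
    have "(\<Sum>i\<in>B. t i) = (\<Sum>i\<in>B. card {p\<in>insert x A. u p = i})"
      using u by simp
    also have "\<dots> = card (\<Union>i\<in>B. {p\<in>insert x A. u p = i})"
      using assms(2) insert(1) by (intro card_UN_disjoint[symmetric]) auto
    also have "(\<Union>i\<in>B. {p\<in>insert x A. u p = i}) = insert x A" using u by auto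
    finally have tot: "(\<Sum>i\<in>B. t i) = Suc (card A)" using insert by simp
    have "card (?U (insert x A) t) * (\<Prod>i\<in>B. fact (t i)) \<le>
        (\<Sum>i\<in>?B. card (?U A (?s i))) * (\<Prod>i\<in>B. fact (t i))"
      using le by simp
    also have "\<dots> = (\<Sum>i\<in>?B. t i * (card (?U A (?s i)) * (\<Prod>j\<in>B. fact (?s i j))))"
      unfolding sum_distrib_right by (intro sum.cong refl) (simp only: prod mult_ac)
    also have "\<dots> \<le> (\<Sum>i\<in>?B. t i * fact (card A))"
      using insert.IH by (intro sum_mono mult_left_mono) auto
    also have "\<dots> = (\<Sum>i\<in>?B. t i) * fact (card A)" by (simp add: sum_distrib_right)
    also have "(\<Sum>i\<in>?B. t i) = (\<Sum>i\<in>B. t i)"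
      using assms(2) by (intro sum.mono_neutral_left) auto
    finally show ?thesis using tot insert by simp
  qed
qed

text \<open>The logarithm of the factorial is convex, so equal counts minimize the product.\<close>

lemma prod_fact_ge_balanced:
  fixes t :: "'a \<Rightarrow> nat"
  assumes "finite B" and "(\<Sum>i\<in>B. t i) = q * card B"
  shows "fact q ^ card B \<le> (\<Prod>i\<in>B. fact (t i) :: nat)"
proof -
  have up: "fact q * (q+1) ^ j \<le> (fact (q + j) :: nat)" for j
  proof (induction j)
    case (Suc j)
    have "fact q * (q+1) ^ Suc j = (q+1) * (fact q * (q+1) ^ j)" by (simp only: power_Suc mult_ac)
    also have "\<dots> \<le> (q + Suc j) * fact (q + j)" using Suc by (intro mult_mono) auto
    finally show ?case by (simp only: add_Suc_right fact_Suc of_nat_id)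
  qed simp
  have down: "fact (s + j) \<le> (fact s :: nat) * (s+j+1) ^ j" for s j
  proof (induction j)
    case (Suc j)
    have "fact (s + Suc j) = (s + Suc j) * (fact (s + j) :: nat)" by simp
    also have "\<dots> \<le> (s + Suc j + 1) * (fact s * (s+j+1) ^ j)" using Suc by (intro mult_mono) auto
    also have "\<dots> \<le> (s + Suc j + 1) * (fact s * (s+Suc j+1) ^ j)"
      by (intro mult_mono power_mono) auto
    finally show ?case by (simp add: mult_ac)
  qed simp
  \<comment> \<open>The supporting line at \<open>q\<close> with slope \<open>ln (q + 1)\<close>,
    exponentiated and cleared of negative exponents. In the product over \<open>B\<close> the powers
    of \<open>q + 1\<close> cancel, because the \<open>t i\<close> average to
    \<open>q\<close>.\<close>
  have tangent: "fact q * (q+1) ^ s \<le> (fact s :: nat) * (q+1) ^ q" for s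
  proof (cases "q \<le> s")
    case True
    then obtain j where j: "s = q + j" using le_Suc_ex by blast
    show ?thesis using mult_right_mono[OF up[of j], of "(q+1)^q"]
      unfolding j by (simp add: power_add mult_ac)
  next
    case False
    then obtain j where j: "q = s + j" using le_Suc_ex nat_le_linear by blast
    have "fact q * (q+1)^s \<le> fact s * (q+1)^j * (q+1)^s"
      using down[of s j] unfolding j by (intro mult_right_mono) auto
    then show ?thesis unfolding j by (simp add: power_add mult_ac)
  qed
  have "(\<Prod>i\<in>B. fact q * (q+1) ^ t i) \<le> (\<Prod>i\<in>B. fact (t i) * (q+1) ^ q)"
    using tangent by (intro prod_mono) auto
  then have "fact q ^ card B * (q+1) ^ (q * card B) \<le>
      (\<Prod>i\<in>B. fact (t i)) * (q+1) ^ (q * card B)"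
    using assms by (simp add: prod.distrib power_sum[symmetric] power_mult[symmetric])
  then show ?thesis by (metis mult_le_cancel2 zero_less_power add_gr_0 less_one)
qed

text \<open>Evaluates the quadratic terms that appear in \<open>prod_arith_le\<close> once the
  factors \<open>j\<close> and \<open>c - j\<close> are paired.\<close>

lemma sum_mult_reflected:
  assumes "c > 0"
  shows "(\<Sum>j=1..<c. (real j / real c) * (1 - real j / real c)) = (real c ^ 2 - 1) / (6 * real c)"
proof -
  have s: "(\<Sum>j=1..<k. real j * (x - real j)) = x * (real k * (real k - 1) / 2) - (real k - 1) * real k * (2 * real k - 1) / 6"
    if "k > 0" for k x
    using that
  proof (induction k rule: nat_induct_non_zero)
    case (Suc k)
    have "(\<Sum>j=1..<Suc k. real j * (x - real j)) = (\<Sum>j=1..<k. real j * (x - real j)) + real k * (x - real k)"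
      using Suc(1) by simp
    then show ?case unfolding Suc(2) by (simp add: field_simps)
  qed simp
  have "(\<Sum>j=1..<c. (real j / real c) * (1 - real j / real c)) = (\<Sum>j=1..<c. real j * (real c - real j)) / (real c ^ 2)"
    unfolding sum_divide_distrib using assms
    by (intro sum.cong) (auto simp: field_simps power2_eq_square)
  also have "\<dots> = (real c ^ 2 - 1) / (6 * real c)"
    unfolding s[OF assms] using assms by (simp add: field_simps power2_eq_square power3_eq_cube)
  finally show ?thesis .
qed

text \<open>Pair the factors \<open>j\<close> and \<open>c - j\<close> of the square and compare arithmetic with geometric mean.\<close>

lemma prod_arith_le:
  fixes s :: real
  assumes c: "c \<ge> 5" and s: "0 < s" "s \<le> 1"
  shows "(\<Prod>j<c. 1 - s * (real j / real c))\<^sup>2 \<le> (1 - 4 * s / (4 + s)) ^ (c - 1)"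
proof -
  let ?x = "\<lambda>j. real j / real c"
  \<comment> \<open>For \<open>s = 1 / (q + 1)\<close> this is \<open>(4 q + 1) / (4 q + 5)\<close>,
    the ratio that telescopes in \<open>balanced_multinomial_bound\<close>.\<close>
  define t where "t = 1 - 4 * s / (4 + s)"
  have T: "t > 0" using s by (simp add: t_def field_simps)
  define y where "y = (\<lambda>j. 1 - s + s\<^sup>2 * (?x j * (1 - ?x j)))"
  have ypos: "y j \<ge> 0" if "j < c" for j
    using that s c unfolding y_def by (intro add_nonneg_nonneg mult_nonneg_nonneg) auto
  have *: "(\<Prod>j<c. 1 - s * ?x j) = (\<Prod>j=1..<c. 1 - s * ?x j)"
  proof -
    have "{..<c} = insert 0 {1..<c}" using c by auto
    then show ?thesis by simp
  qed
  have **: "(\<Prod>j=1..<c. 1 - s * ?x j) = (\<Prod>j=1..<c. 1 - s * (1 - ?x j))"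
    using c by (intro prod.reindex_bij_witness[of _ "\<lambda>j. c - j" "\<lambda>j. c - j"])
      (auto simp: of_nat_diff field_simps)
  have "(\<Prod>j<c. 1 - s * ?x j)\<^sup>2 = (\<Prod>j=1..<c. 1 - s * ?x j) * (\<Prod>j=1..<c. 1 - s * (1 - ?x j))"
    unfolding power2_eq_square * using ** by simp
  also have "\<dots> = (\<Prod>j=1..<c. y j)"
    unfolding prod.distrib[symmetric] y_def by (intro prod.cong) (auto simp: algebra_simps power2_eq_square)
  also have "\<dots> = (\<Prod>j=1..<c. y j / t) * t ^ (c - 1)"
  proof -
    have "(\<Prod>j=1..<c. y j) = (\<Prod>j=1..<c. y j / t * t)"
      using less_imp_neq[OF T] by (intro prod.cong refl) (metis nonzero_eq_divide_eq)
    then show ?thesis by (simp only: prod.distrib prod_constant card_atLeastLessThan)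
  qed
  \<comment> \<open>The inequality \<open>z <= exp (z - 1)\<close> compares the means: the product
    is at most 1 once the \<open>y j\<close> average at most \<open>t\<close>.\<close>
  also have "(\<Prod>j=1..<c. y j / t) \<le> (\<Prod>j=1..<c. exp (y j / t - 1))"
    using ypos T by (intro prod_mono) (auto intro: order_trans[OF _ exp_ge_add_one_self])
  also have "\<dots> = exp (\<Sum>j=1..<c. y j / t - 1)" by (simp add: exp_sum)
  also have "(\<Sum>j=1..<c. y j / t - 1) = ((\<Sum>j=1..<c. y j) - (real c - 1) * t) / t"
    using T c by (simp add: sum_subtractf sum_divide_distrib[symmetric] diff_divide_distrib of_nat_diff)
  also have "exp \<dots> \<le> 1"
  proof -
    have "(\<Sum>j=1..<c. y j) = (real c - 1) * (1 - s) + s\<^sup>2 * ((real c ^ 2 - 1) / (6 * real c))"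
      unfolding y_def sum.distrib sum_distrib_left[symmetric] using sum_mult_reflected[of c] c
      by (simp add: of_nat_diff)
    also have "(real c ^ 2 - 1) / (6 * real c) = (real c - 1) * ((real c + 1) / (6 * real c))"
      by (simp add: power2_eq_square algebra_simps)
    \<comment> \<open>Equivalent to \<open>c >= 5\<close>.\<close>
    also have "(real c + 1) / (6 * real c) \<le> 1 / 5" using c by (simp add: field_simps)
    finally have "(\<Sum>j=1..<c. y j) \<le> (real c - 1) * (1 - s) + s\<^sup>2 * ((real c - 1) * (1 / 5))"
      using c by (simp add: mult_left_mono)
    also have "\<dots> = (real c - 1) * (1 - s + s\<^sup>2 / 5)" by (simp add: algebra_simps)
    \<comment> \<open>After multiplication by \<open>4 + s\<close>, the right factors differ by
      \<open>s^2 (1 - s) / 5\<close>.\<close>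
    also have "\<dots> \<le> (real c - 1) * t"
    proof (rule mult_left_mono)
      have "s * s \<le> s" using s by (simp add: mult_left_le)
      then have "s * (s * s) \<le> s * s" using s by (simp add: mult_left_mono)
      then show "1 - s + s\<^sup>2 / 5 \<le> t" using s by (simp add: t_def field_simps power2_eq_square)
    qed (use c in simp)
    finally show ?thesis using T by (simp add: divide_nonpos_pos)
  qed
  finally show ?thesis using T by (simp add: t_def)
qed

text \<open>The most likely color count of \<open>q * c\<close> points has probability at most \<open>(4 * q + 1) powr (- (c - 1) / 2)\<close>.\<close>

lemma balanced_multinomial_bound:
  assumes c: "c \<ge> 5"
  shows "(fact (q * c) / (fact q ^ c * real c ^ (q * c)))\<^sup>2 * real (4 * q + 1) ^ (c - 1) \<le> 1"
proof (induction q)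
  case 0
  show ?case by simp
next
  case (Suc q)
  \<comment> \<open>The factor by which the probability changes when another \<open>c\<close> points
    are colored.\<close>
  define r where "r = (\<Prod>j<c. 1 - (1 / real (Suc q)) * (real j / real c))"
  let ?p = "\<lambda>q. fact (q * c) / (fact q ^ c * real c ^ (q * c)) :: real"
  have "fact (Suc q * c) = fact (q * c) * (\<Prod>j<c. real (Suc q * c) - real j)"
  proof -
    have "fact (k + i) = fact k * (\<Prod>j<i. real (k + i) - real j)" for k i
    proof (induction i)
      case (Suc i)
      have "(\<Prod>j<Suc i. real (k + Suc i) - real j) = real (k + Suc i) * (\<Prod>j<i. real (k + i) - real j)"
        by (subst prod.lessThan_Suc_shift) (auto intro!: arg_cong2[of _ _ _ _ "(*)"] prod.cong)
      then show ?case using Suc by (simp add: mult_ac)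
    qed simp
    from this[of "q * c" c] show ?thesis by (simp add: add.commute)
  qed
  also have "(\<Prod>j<c. real (Suc q * c) - real j) = (\<Prod>j<c. real (Suc q * c) * (1 - (1 / real (Suc q)) * (real j / real c)))"
  proof (intro prod.cong refl)
    fix j
    have "real (Suc q * c) * ((1 / real (Suc q)) * (real j / real c)) = real j"
      using c unfolding of_nat_mult by (simp del: of_nat_Suc)
    then show "real (Suc q * c) - real j = real (Suc q * c) * (1 - (1 / real (Suc q)) * (real j / real c))"
      by (simp only: right_diff_distrib mult_1_right)
  qed
  also have "\<dots> = real (Suc q * c) ^ c * r" by (simp add: r_def prod.distrib)
  finally have f: "fact (Suc q * c) = fact (q * c) * (real (Suc q * c) ^ c * r)" .
  then have p: "?p (Suc q) = ?p q * r"
  proof -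
    have "real (Suc q * c) ^ c = real (Suc q) ^ c * real c ^ c"
      by (simp only: of_nat_mult power_mult_distrib)
    moreover have "fact (Suc q) ^ c = (real (Suc q) ^ c * fact q ^ c :: real)"
      by (simp only: fact_Suc of_nat_mult power_mult_distrib)
    moreover have "real c ^ (Suc q * c) = real c ^ c * real c ^ (q * c)"
      by (simp add: power_add)
    moreover have "real (Suc q) ^ c \<noteq> 0" "real c ^ c \<noteq> 0" using c by simp_all
    ultimately show ?thesis
      using f by (simp del: of_nat_Suc fact_Suc mult_Suc)
  qed
  have "r\<^sup>2 \<le> (1 - 4 * (1 / real (Suc q)) / (4 + 1 / real (Suc q))) ^ (c - 1)"
    unfolding r_def by (intro prod_arith_le c) auto
  also have "1 - 4 * (1 / real (Suc q)) / (4 + 1 / real (Suc q)) = real (4 * q + 1) / real (4 * Suc q + 1)"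
  proof -
    have "4 * (1 / x) / (4 + 1 / x) = 4 / (4 * x + 1)" if "x > 0" for x :: real
      using that add_pos_pos[of 4 "1 / x"] by (subst frac_eq_eq) (auto simp: algebra_simps)
    from this[of "real (Suc q)"] show ?thesis by (simp add: field_simps)
  qed
  finally have r: "r\<^sup>2 * real (4 * Suc q + 1) ^ (c - 1) \<le> real (4 * q + 1) ^ (c - 1)"
    by (simp add: power_divide field_simps)
  have "(?p (Suc q))\<^sup>2 * real (4 * Suc q + 1) ^ (c - 1) = (?p q)\<^sup>2 * (r\<^sup>2 * real (4 * Suc q + 1) ^ (c - 1))"
    unfolding p by (simp only: power_mult_distrib mult_ac)
  also have "\<dots> \<le> (?p q)\<^sup>2 * real (4 * q + 1) ^ (c - 1)"
    using r by (intro mult_left_mono) auto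
  finally show ?case using Suc by linarith
qed

section \<open>Union bound and counting method\<close>

text \<open>Splits \<open>h\<close> into its parts outside and on \<open>A\<close>. In the union
  bound \<open>H\<close> consists of all colorings of \<open>X - A\<close>, in the counting argument
  only of the good ones.\<close>

lemma card_bad_extensions_le:
  assumes finX: "finite X" and finB: "finite B" and A: "A \<subseteq> X" and H: "finite H"
    and K: "\<And>h. card {u \<in> A \<rightarrow>\<^sub>E B. bad (override_on h u A)} \<le> K"
  shows "card {h \<in> X \<rightarrow>\<^sub>E B. restrict h (X - A) \<in> H \<and> bad h} \<le> K * card H"
proof -
  let ?ext = "\<lambda>h. {u \<in> A \<rightarrow>\<^sub>E B. bad (override_on h u A)}"
  let ?F = "(\<lambda>(h, u). override_on h u A)"
  have finA: "finite (A \<rightarrow>\<^sub>E B)" using finite_subset[OF A finX] finB by (simp add: finite_PiE)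
  then have fin: "finite (SIGMA h:H. ?ext h)" using H by (intro finite_SigmaI) auto
  have "{h \<in> X \<rightarrow>\<^sub>E B. restrict h (X - A) \<in> H \<and> bad h} \<subseteq> ?F ` (SIGMA h:H. ?ext h)"
  proof
    fix h assume h: "h \<in> {h \<in> X \<rightarrow>\<^sub>E B. restrict h (X - A) \<in> H \<and> bad h}"
    have ov: "override_on (restrict h (X - A)) (restrict h A) A = h"
      using h A by (auto simp: override_on_def fun_eq_iff PiE_iff extensional_def)
    have "restrict h A \<in> A \<rightarrow>\<^sub>E B" using h A by auto
    then have "(restrict h (X - A), restrict h A) \<in> (SIGMA h:H. ?ext h)" using h ov by simp
    then show "h \<in> ?F ` (SIGMA h:H. ?ext h)" using ov by (metis (no_types, lifting) case_prod_conv image_eqI)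
  qed
  then have "card {h \<in> X \<rightarrow>\<^sub>E B. restrict h (X - A) \<in> H \<and> bad h} \<le> card (SIGMA h:H. ?ext h)"
    using fin by (rule surj_card_le[rotated])
  also have "\<dots> = (\<Sum>h\<in>H. card (?ext h))"
    using H finA by (intro card_SigmaI) auto
  also have "\<dots> \<le> (\<Sum>h\<in>H. K)" using K by (intro sum_mono)
  finally show ?thesis by (simp add: mult.commute)
qed

text \<open>Given the colors outside \<open>A\<close>, a random coloring is bad for \<open>e\<close>
  with probability at most \<open>K / card B ^ r\<close>. The assumption \<open>less\<close> says
  that these probabilities sum to less than 1.\<close>

lemma union_bound_coloring:
  assumes finT: "finite T" and finB: "finite B" and "B \<noteq> {}" and finE: "finite E"
    and few: "\<And>e. e \<in> E \<Longrightarrow> \<exists>A\<subseteq>T. card A = r \<and>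
      (\<forall>h. card {u \<in> A \<rightarrow>\<^sub>E B. bad e (override_on h u A)} \<le> K)"
    and less: "card E * K < card B ^ r"
  shows "\<exists>h\<in>T \<rightarrow>\<^sub>E B. \<forall>e\<in>E. \<not> bad e h"
proof (rule ccontr)
  assume neg: "\<not> ?thesis"
  let ?bad = "\<lambda>e. {h \<in> T \<rightarrow>\<^sub>E B. bad e h}"
  have B: "card B > 0" using finB \<open>B \<noteq> {}\<close> by (simp add: card_gt_0_iff)
  have finTB: "finite (T \<rightarrow>\<^sub>E B)" using finT finB by (simp add: finite_PiE)
  have bad: "card (?bad e) * card B ^ r \<le> K * card B ^ card T" if e: "e \<in> E" for e
  proof -
    obtain A where A: "A \<subseteq> T" "card A = r"
      "\<forall>h. card {u \<in> A \<rightarrow>\<^sub>E B. bad e (override_on h u A)} \<le> K"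
      using few[OF e] by (elim exE conjE)
    have "?bad e \<subseteq> {h \<in> T \<rightarrow>\<^sub>E B. restrict h (T - A) \<in> (T - A) \<rightarrow>\<^sub>E B \<and> bad e h}" by auto
    then have "card (?bad e) \<le> card {h \<in> T \<rightarrow>\<^sub>E B. restrict h (T - A) \<in> (T - A) \<rightarrow>\<^sub>E B \<and> bad e h}"
      using finTB by (intro card_mono) auto
    also have "\<dots> \<le> K * card ((T - A) \<rightarrow>\<^sub>E B)"
      using A finT finB by (intro card_bad_extensions_le finite_PiE) auto
    also have "card ((T - A) \<rightarrow>\<^sub>E B) = card B ^ (card T - r)"
      using A finT by (simp add: card_PiE card_Diff_subset finite_subset)
    finally have "card (?bad e) * card B ^ r \<le> K * card B ^ (card T - r) * card B ^ r" by simp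
    also have "\<dots> = K * card B ^ card T"
      using card_mono[OF finT A(1)] A(2) by (simp add: mult.assoc power_add[symmetric])
    finally show ?thesis .
  qed
  have "T \<rightarrow>\<^sub>E B \<subseteq> (\<Union>e\<in>E. ?bad e)" using neg by blast
  then have "card (T \<rightarrow>\<^sub>E B) \<le> card (\<Union>e\<in>E. ?bad e)"
    using finE finTB by (intro card_mono) auto
  also have "\<dots> \<le> (\<Sum>e\<in>E. card (?bad e))" using finE by (rule card_UN_le)
  finally have "card B ^ card T * card B ^ r \<le> (\<Sum>e\<in>E. card (?bad e)) * card B ^ r"
    using finT by (simp add: card_PiE)
  also have "\<dots> \<le> (\<Sum>e\<in>E. K * card B ^ card T)"
    unfolding sum_distrib_right using bad by (rule sum_mono)
  also have "\<dots> = card B ^ card T * (card E * K)" by simp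
  finally show False using less B by simp
qed

text \<open>
  Rosenfeld's counting argument.  Extending a good coloring by one point multiplies the number of
  good colorings by at least \<open>\<beta>\<close>: an extension that violates a constraint is determined, up to \<open>K\<close>
  possibilities, by a good coloring that leaves out \<open>m\<close> points of its support, and by induction there
  are fewer of these by a factor \<open>\<beta> ^ (m - 1)\<close>.
\<close>

lemma rosenfeld_counting_coloring:
  fixes \<beta> :: real
  assumes finT: "finite T" and finB: "finite B" and finE: "finite E"
    and supp: "\<And>e. e \<in> E \<Longrightarrow> supp e \<subseteq> T \<and> supp e \<noteq> {}"
    and local: "\<And>e h h'. e \<in> E \<Longrightarrow> (\<And>p. p \<in> supp e \<Longrightarrow> h p = h' p) \<Longrightarrow> bad e h = bad e h'"
    and deg: "\<And>v. v \<in> T \<Longrightarrow> card {e\<in>E. v \<in> supp e} \<le> q"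
    and few: "\<And>e v. e \<in> E \<Longrightarrow> v \<in> supp e \<Longrightarrow> \<exists>A\<subseteq>supp e. v \<in> A \<and> card A = m \<and>
      (\<forall>h. card {u \<in> A \<rightarrow>\<^sub>E B. bad e (override_on h u A)} \<le> K)"
    and \<beta>: "\<beta> > 0" "\<beta> + real q * real K / \<beta> ^ (m - 1) \<le> real (card B)"
  shows "\<exists>h\<in>T \<rightarrow>\<^sub>E B. \<forall>e\<in>E. \<not> bad e h"
proof -
  \<comment> \<open>Only constraints supported inside \<open>X\<close> are imposed, so restrictions
    of good colorings stay good.\<close>
  define good where "good = (\<lambda>X. {h \<in> X \<rightarrow>\<^sub>E B. \<forall>e\<in>E. supp e \<subseteq> X \<longrightarrow> \<not> bad e h})"
  have finG: "finite (good X)" if "X \<subseteq> T" for X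
    using finite_subset[OF that finT] finB unfolding good_def by (simp add: finite_PiE)
  have restr: "restrict h Y \<in> good Y" if h: "h \<in> good X" and "Y \<subseteq> X" for h X Y
  proof -
    have "\<not> bad e (restrict h Y)" if e: "e \<in> E" "supp e \<subseteq> Y" for e
    proof -
      have "bad e (restrict h Y) = bad e h" using e by (intro local) auto
      moreover have "\<not> bad e h" using e h \<open>Y \<subseteq> X\<close> unfolding good_def by auto
      ultimately show ?thesis by simp
    qed
    moreover have "restrict h Y \<in> Y \<rightarrow>\<^sub>E B"
      using h \<open>Y \<subseteq> X\<close> unfolding good_def by (simp add: PiE_iff subset_iff)
    ultimately show ?thesis unfolding good_def by simp
  qed
  have step: "\<beta> * card (good X) \<le> card (good (insert v X))" if "insert v X \<subseteq> T" "v \<notin> X" for v X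
    using that
  proof (induction "card X" arbitrary: v X rule: less_induct)
    case less
    let ?X = "insert v X"
    have finX: "finite X" using less.prems finite_subset[OF _ finT] by simp
    \<comment> \<open>The induction hypothesis, iterated over the points of \<open>Z\<close>; it
      applies because each set that gains a point is still a proper subset of
      \<open>X\<close>.\<close>
    have chain: "\<beta> ^ card Z * card (good Y) \<le> card (good (Y \<union> Z))"
      if "Y \<union> Z \<subseteq> X" "Y \<inter> Z = {}" for Y Z
    proof -
      have "finite Z" using that finite_subset[OF _ finX] by simp
      then show ?thesis using that
      proof (induction Z rule: finite_induct)
        case (insert z Z)
        have "card (Y \<union> Z) < card X"
          using insert finX by (intro psubset_card_mono) auto
        then have "\<beta> * card (good (Y \<union> Z)) \<le> card (good (insert z (Y \<union> Z)))"
          using insert less.prems by (intro less.hyps) auto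
        moreover have "\<beta> * (\<beta> ^ card Z * card (good Y)) \<le> \<beta> * card (good (Y \<union> Z))"
          using insert \<beta>(1) by (intro mult_left_mono) auto
        ultimately show ?case using insert by (simp add: mult.assoc)
      qed simp
    qed
    \<comment> \<open>All extensions of good colorings of \<open>X\<close> to \<open>v\<close>. A
      constraint violated by one of them must have \<open>v\<close> in its support, which leaves at
      most \<open>q\<close> constraints.\<close>
    let ?G = "{h \<in> ?X \<rightarrow>\<^sub>E B. restrict h X \<in> good X}"
    let ?bad = "\<lambda>e. {h \<in> ?G. bad e h}"
    let ?E = "{e\<in>E. v \<in> supp e}"
    let ?E' = "{e\<in>?E. supp e \<subseteq> ?X}"
    have finGX: "finite ?G" using finX finB by (simp add: finite_PiE)
    have finbad: "finite (?bad e)" for e by (rule finite_subset[OF _ finGX]) auto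
    have G: "card ?G = card B * card (good X)"
    proof -
      have bij: "bij_betw (\<lambda>(b, h). h(v := b)) (B \<times> good X) ?G"
      proof (rule bij_betw_byWitness[where f' = "\<lambda>h. (h v, restrict h X)"])
        have ext: "restrict (h(v := b)) X = h" if "h \<in> good X" for h b
        proof
          fix x
          show "restrict (h(v := b)) X x = h x"
            using that less.prems(2) unfolding good_def by (cases "x \<in> X") (auto simp: PiE_iff extensional_def)
        qed
        show "\<forall>a\<in>B \<times> good X. (\<lambda>h. (h v, restrict h X)) ((\<lambda>(b, h). h(v := b)) a) = a"
          using ext by simp
        show "(\<lambda>(b, h). h(v := b)) ` (B \<times> good X) \<subseteq> ?G"
        proof clarify
          fix b h assume bh: "b \<in> B" "h \<in> good X"
          then have "h(v := b) \<in> ?X \<rightarrow>\<^sub>E B" unfolding good_def by (auto simp: PiE_iff extensional_def)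
          with bh ext show "h(v := b) \<in> ?X \<rightarrow>\<^sub>E B \<and> restrict (h(v := b)) X \<in> good X" by simp
        qed
        show "\<forall>h\<in>?G. (\<lambda>(b, h). h(v := b)) (h v, restrict h X) = h"
        proof
          fix h assume h: "h \<in> ?G"
          have "((restrict h X)(v := h v)) x = h x" for x
            using h by (cases "x = v") (auto simp: PiE_iff extensional_def restrict_def)
          then show "(\<lambda>(b, h). h(v := b)) (h v, restrict h X) = h" by auto
        qed
        show "(\<lambda>h. (h v, restrict h X)) ` ?G \<subseteq> B \<times> good X" by (auto simp: PiE_iff)
      qed
      show ?thesis using bij_betw_same_card[OF bij] by (simp add: card_cartesian_product)
    qed
    have bad: "real (card (?bad e)) \<le> K * (card (good X) / \<beta> ^ (m - 1))" if e: "e \<in> ?E'" for e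
    proof -
      have ev: "e \<in> E" "v \<in> supp e" using e by auto
      obtain A where A: "A \<subseteq> supp e" "v \<in> A" "card A = m"
        "\<forall>h. card {u \<in> A \<rightarrow>\<^sub>E B. bad e (override_on h u A)} \<le> K"
        using few[OF ev] by (elim exE conjE)
      have AX: "A \<subseteq> ?X" using A e by auto
      have sub: "?X - A \<subseteq> X" using A by auto
      have "?bad e \<subseteq> {h \<in> ?X \<rightarrow>\<^sub>E B. restrict h (?X - A) \<in> good (?X - A) \<and> bad e h}"
      proof clarify
        fix h assume "restrict h X \<in> good X"
        then have "restrict (restrict h X) (?X - A) \<in> good (?X - A)" by (rule restr[OF _ sub])
        then show "restrict h (?X - A) \<in> good (?X - A)" using sub by (simp add: Int_absorb1)
      qed
      then have "card (?bad e) \<le> card {h \<in> ?X \<rightarrow>\<^sub>E B. restrict h (?X - A) \<in> good (?X - A) \<and> bad e h}"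
        using finX finB by (intro card_mono) (simp_all add: finite_PiE)
      also have "\<dots> \<le> K * card (good (?X - A))"
        using AX A finX finB less.prems by (intro card_bad_extensions_le finG) auto
      finally have le: "card (?bad e) \<le> K * card (good (?X - A))" .
      \<comment> \<open>Since \<open>v\<close> is not in \<open>X\<close>, only \<open>m - 1\<close>
        points of \<open>A\<close> are removed from \<open>X\<close>; hence the exponent.\<close>
      have "card (A - {v}) = m - 1" using A by simp
      moreover have "(?X - A) \<union> (A - {v}) = X" using AX A less.prems by auto
      ultimately have "\<beta> ^ (m - 1) * card (good (?X - A)) \<le> card (good X)"
        using chain[of "?X - A" "A - {v}"] by auto
      then have "real (card (good (?X - A))) \<le> card (good X) / \<beta> ^ (m - 1)"
        using \<beta>(1) by (simp add: field_simps)
      then have "real K * card (good (?X - A)) \<le> K * (card (good X) / \<beta> ^ (m - 1))"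
        by (intro mult_left_mono) auto
      moreover have "real (card (?bad e)) \<le> real K * card (good (?X - A))"
        using le by (simp only: of_nat_mult[symmetric] of_nat_le_iff)
      ultimately show ?thesis by (rule order_trans[rotated])
    qed
    have cover: "?G \<subseteq> good ?X \<union> (\<Union>e\<in>?E'. ?bad e)"
    proof
      fix h assume h: "h \<in> ?G"
      show "h \<in> good ?X \<union> (\<Union>e\<in>?E'. ?bad e)"
      proof (rule ccontr)
        assume neg: "h \<notin> good ?X \<union> (\<Union>e\<in>?E'. ?bad e)"
        then obtain e where e: "e \<in> E" "supp e \<subseteq> ?X" "bad e h" using h unfolding good_def by auto
        then have v: "v \<notin> supp e" using neg h by auto
        then have "bad e (restrict h X) = bad e h" using e by (intro local) auto
        then show False using h e v unfolding good_def by auto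
      qed
    qed
    have "real (card ?G) \<le> card (good ?X) + (\<Sum>e\<in>?E'. real (card (?bad e)))"
    proof -
      have "card ?G \<le> card (good ?X \<union> (\<Union>e\<in>?E'. ?bad e))"
        using cover finG[OF less.prems(1)] finE
        by (intro card_mono finite_UnI finite_UN_I finbad) auto
      also have "\<dots> \<le> card (good ?X) + card (\<Union>e\<in>?E'. ?bad e)" by (rule card_Un_le)
      also have "card (\<Union>e\<in>?E'. ?bad e) \<le> (\<Sum>e\<in>?E'. card (?bad e))"
        using finE by (intro card_UN_le) auto
      finally show ?thesis by (simp flip: of_nat_sum of_nat_add)
    qed
    also have "(\<Sum>e\<in>?E'. real (card (?bad e))) \<le> (\<Sum>e\<in>?E'. K * (card (good X) / \<beta> ^ (m - 1)))"
      using bad by (rule sum_mono)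
    also have "\<dots> = card ?E' * (K * (card (good X) / \<beta> ^ (m - 1)))" by simp
    also have "\<dots> \<le> q * (K * (card (good X) / \<beta> ^ (m - 1)))"
    proof (rule mult_right_mono)
      have "card ?E' \<le> card ?E" using finE by (intro card_mono) auto
      also have "\<dots> \<le> q" using less.prems by (intro deg) auto
      finally show "real (card ?E') \<le> real q" by simp
    qed (use \<beta> in simp)
    finally have "real (card B) * card (good X) - real q * real K / \<beta> ^ (m - 1) * card (good X)
        \<le> card (good ?X)"
      unfolding G by simp
    moreover have "\<beta> * card (good X) \<le> (real (card B) - real q * real K / \<beta> ^ (m - 1)) * card (good X)"
      using \<beta>(2) by (intro mult_right_mono) auto
    ultimately show ?case by (simp add: left_diff_distrib)
  qed
  have "card (good X) > 0" if "X \<subseteq> T" for X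
    using finite_subset[OF that finT] that
  proof (induction X rule: finite_induct)
    case empty
    \<comment> \<open>The empty coloring is good because no constraint has empty support.\<close>
    have "(\<lambda>_. undefined) \<in> good {}" using supp unfolding good_def by auto
    then show ?case using finG[OF empty] by (auto simp: card_gt_0_iff)
  next
    case (insert x X)
    then have "0 < \<beta> * card (good X)" using \<beta>(1) by simp
    also have "\<dots> \<le> card (good (insert x X))" using insert by (intro step)
    finally show ?case by simp
  qed
  from this[OF order_refl] obtain h where "h \<in> good T" by (auto simp: card_gt_0_iff)
  then show ?thesis using supp unfolding good_def by blast
qed

section \<open>The color bound\<close>

text \<open>The last identity is the form that the counting method needs: the growth factor
  \<open>\<beta>\<close> plus the extensions lost to bad pairs.\<close>

lemma color_bound_eq_root:
  assumes "m \<ge> 2" "a > 0" "b > 0"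
  defines "\<beta> \<equiv> root m (fact m * real a * real b * (real m - 1))"
  shows "\<beta> > 0" and "color_bound a b m = real m / (real m - 1) * \<beta>"
    and "\<beta> ^ m = fact m * real (a * b) * (real m - 1)"
    and "color_bound a b m = \<beta> + real (a * b) * fact m / \<beta> ^ (m - 1)"
proof -
  have pos: "fact m * real a * real b * (real m - 1) > 0" using assms by simp
  show \<beta>: "\<beta> > 0" unfolding \<beta>_def using pos assms(1) by (intro real_root_gt_zero) auto
  show cb: "color_bound a b m = real m / (real m - 1) * \<beta>" by (simp add: color_bound_def \<beta>_def)
  show pw: "\<beta> ^ m = fact m * real (a * b) * (real m - 1)"
    unfolding \<beta>_def using pos assms(1) by (subst real_root_pow_pos2) auto
  have "\<beta> * \<beta> ^ (m - 1) = \<beta> ^ m" using assms(1) by (cases m) auto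
  then have "real (a * b) * fact m / \<beta> ^ (m - 1) = \<beta> / (real m - 1)"
    using pw \<beta> assms(1) by (simp add: frac_eq_eq mult_ac)
  then show "color_bound a b m = \<beta> + real (a * b) * fact m / \<beta> ^ (m - 1)"
    unfolding cb using assms(1) by (simp add: field_simps)
qed

text \<open>The root \<open>y\<close> minimizes the right-hand side over all positive
  \<open>x\<close>. Bernoulli's inequality at \<open>y / x\<close> stands in for the weighted mean
  inequality.\<close>

lemma color_bound_le:
  assumes "k \<ge> 2" "a > 0" "b > 0" "x > 0"
  shows "color_bound a b k \<le> x + real (a * b) * fact k / x ^ (k - 1)"
proof -
  define y where "y = root k (fact k * real a * real b * (real k - 1))"
  note y = color_bound_eq_root[OF assms(1-3), folded y_def]
  have k: "real k - 1 > 0" using assms(1) by simp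
  have "1 + real k * (y / x - 1) \<le> (1 + (y / x - 1)) ^ k"
    using y(1) assms(4) by (intro Bernoulli_inequality) simp
  then have "real k * (y / x) \<le> (real k - 1) + (y / x) ^ k" by (simp add: algebra_simps)
  then have "x * (real k * (y / x)) \<le> x * ((real k - 1) + (y / x) ^ k)"
    using assms(4) by (intro mult_left_mono) auto
  also have "x * (real k * (y / x)) = real k * y" using assms(4) by simp
  finally have "real k * y / (real k - 1) \<le> x * ((real k - 1) + (y / x) ^ k) / (real k - 1)"
    using k by (intro divide_right_mono) auto
  also have "\<dots> = x + x * (y / x) ^ k / (real k - 1)"
    using k by (simp add: distrib_left add_divide_distrib)
  also have "x * (y / x) ^ k / (real k - 1) = real (a * b) * fact k / x ^ (k - 1)"
  proof -
    have "x ^ k = x * x ^ (k - 1)" using assms(1) by (cases k) auto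
    then show ?thesis using y(3) k assms(4) by (simp add: power_divide)
  qed
  finally show ?thesis unfolding y(2) by simp
qed

text \<open>
  At a minimizer \<open>m\<close> the two-variable function \<open>x + a b m! / x ^ (m - 1)\<close> cannot be decreased by
  passing to \<open>m - 1\<close>, which forces the optimal \<open>x\<close> to be at least \<open>m\<close>.
\<close>

lemma color_bound_minimizer_gt:
  assumes "m \<ge> 3" "a > 0" "b > 0" and min: "color_bound a b m \<le> color_bound a b (m - 1)"
  shows "color_bound a b m > real m + 1"
proof -
  have m2: "m \<ge> 2" using assms(1) by simp
  define y where "y = root m (fact m * real a * real b * (real m - 1))"
  note y = color_bound_eq_root[OF m2 assms(2,3), folded y_def]
  \<comment> \<open>The point \<open>y\<close> need not be optimal for \<open>m - 1\<close>, but the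
    value there still bounds \<open>color_bound a b (m - 1)\<close> from above.\<close>
  have "y + real (a * b) * fact m / y ^ (m - 1) \<le> y + real (a * b) * fact (m - 1) / y ^ (m - 2)"
  proof -
    have "color_bound a b (m - 1) \<le> y + real (a * b) * fact (m - 1) / y ^ (m - 1 - 1)"
      using assms(1-3) y(1) by (intro color_bound_le) linarith+
    moreover have "m - 1 - 1 = m - 2" by simp
    ultimately show ?thesis using min unfolding y(4) by simp
  qed
  moreover have "fact m = real m * fact (m - 1)" using assms(1) by (simp add: fact_reduce)
  moreover have "y ^ (m - 1) = y * y ^ (m - 2)"
    using assms(1) by (metis Suc_1 Suc_diff_Suc Suc_le_eq diff_Suc_1' m2 power_Suc)
  ultimately have "real (a * b) * fact (m - 1) / y ^ (m - 2) * (real m / y)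
      \<le> real (a * b) * fact (m - 1) / y ^ (m - 2) * 1"
    by (simp add: mult_ac)
  then have "real m / y \<le> 1"
    using y(1) assms(2,3) by (subst (asm) mult_le_cancel_left_pos) auto
  then have "real m \<le> y" using y(1) by simp
  then have "real m / (real m - 1) * real m \<le> color_bound a b m"
    unfolding y(2) using m2 by (intro mult_left_mono) auto
  moreover have "real m + 1 < real m / (real m - 1) * real m"
    using m2 by (simp add: field_simps)
  ultimately show ?thesis by simp
qed

text \<open>Cleared of roots and denominators, the bound becomes, for concrete \<open>m\<close> and
  \<open>c\<close>, a numerical upper bound on \<open>a * b\<close>.\<close>

lemma color_bound_le_imp:
  assumes "m \<ge> 2" "a > 0" "b > 0" "color_bound a b m \<le> real c"
  shows "fact m * (a * b) * (m - 1) * m ^ m \<le> (c * (m - 1)) ^ m"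
proof -
  define y where "y = root m (fact m * real a * real b * (real m - 1))"
  note y = color_bound_eq_root[OF assms(1-3), folded y_def]
  have "real m * y \<le> real c * (real m - 1)"
    using assms(1,4) unfolding y(2) by (simp add: field_simps)
  then have "(real m * y) ^ m \<le> (real c * (real m - 1)) ^ m"
    using y(1) by (intro power_mono) auto
  then have "real (fact m * (a * b) * (m - 1) * m ^ m) \<le> real ((c * (m - 1)) ^ m)"
    using assms(1) by (simp add: power_mult_distrib y(3) of_nat_diff mult_ac)
  then show ?thesis by (simp only: of_nat_le_iff)
qed

text \<open>Minimality gives \<open>m + 1 < 12\<close>, so finitely many \<open>m\<close> remain.
  The value 661 comes from \<open>m = 10\<close>, the weakest case.\<close>

lemma color_bound_minimizer_le_12:
  assumes "m \<ge> 2" "a > 0" "b > 0" and min: "\<forall>k\<ge>2. color_bound a b m \<le> color_bound a b k"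
    and le: "color_bound a b m \<le> 12"
  shows "a * b \<le> 661"
proof -
  have "m \<le> 10"
  proof (rule ccontr)
    assume "\<not> m \<le> 10"
    then show False using color_bound_minimizer_gt[of m a b] assms by auto
  qed
  then consider "m = 2" | "m = 3" | "m = 4" | "m = 5" | "m = 6" | "m = 7" | "m = 8" | "m = 9" | "m = 10"
    using assms(1) by linarith
  then show ?thesis
    using color_bound_le_imp[of m a b 12] assms
    by cases (simp_all add: fact_numeral)
qed

text \<open>Reduces lower bounds on logarithms to powers of rationals, using
  \<open>exp 1 < 68 / 25\<close>.\<close>

lemma ln_gt_rational:
  assumes "0 < p" "0 < q" "0 < x" "(68 / 25) ^ p \<le> x ^ q"
  shows "real p / real q < ln (x :: real)"
proof -
  have "exp (real p) = exp 1 ^ p" by (simp add: exp_of_nat_mult[symmetric])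
  also have "\<dots> < (68 / 25) ^ p" using e_less_272 assms(1) by (intro power_strict_mono) auto
  also have "\<dots> \<le> x ^ q" by (rule assms)
  finally have "real p < ln (x ^ q)"
    using assms(3) ln_less_cancel_iff[of "exp (real p)" "x ^ q"] by simp
  also have "ln (x ^ q) = real q * ln x" using assms by (simp add: ln_realpow)
  finally show ?thesis using assms by (simp add: field_simps)
qed

section \<open>Incidences in projective planes\<close>

context projective_plane
begin

lemma finite_lines: "finite L"
  using finite_subset[of L "Pow P"] finite_points lines_subset by blast

lemma finite_line: "l \<in> L \<Longrightarrow> finite l"
  using finite_points lines_subset finite_subset by metis

lemma common_point_unique:
  assumes "l \<in> L" "l' \<in> L" "l \<noteq> l'" "p \<in> l" "p \<in> l'" "q \<in> l" "q \<in> l'"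
  shows "p = q"
  using unique_point[OF assms(1-3)] assms by blast

lemma card_inter_lines:
  assumes "l \<in> L" "l' \<in> L" "l \<noteq> l'"
  shows "card (l \<inter> l') = 1"
proof -
  obtain p where "p \<in> l \<inter> l'" "\<And>q. q \<in> l \<inter> l' \<Longrightarrow> q = p"
    using unique_point[OF assms] by (metis IntE IntI)
  then have "l \<inter> l' = {p}" by blast
  then show ?thesis by simp
qed

lemma card_Diff_lines:
  assumes "l \<in> L" "l' \<in> L" "l \<noteq> l'"
  shows "card (l - l') = n"
  using card_Diff_subset_Int[of l l'] card_inter_lines[OF assms] card_line[OF assms(1)]
    finite_line assms by simp

lemma card_Un_lines:
  assumes "l \<in> L" "l' \<in> L" "l \<noteq> l'"
  shows "card (l \<union> l') = 2 * n + 1"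
  using card_Un_Int[of l l'] card_inter_lines[OF assms] card_line assms finite_line by simp

text \<open>If all lines passed through \<open>p\<close>, two different lines joining points of the
  quadrangle would share both \<open>p\<close> and a quadrangle point \<open>a\<close> different
  from \<open>p\<close>.\<close>

lemma ex_line_avoiding:
  assumes p: "p \<in> P"
  shows "\<exists>l\<in>L. p \<notin> l"
proof (rule ccontr)
  assume "\<not> ?thesis"
  then have all: "p \<in> l" if "l \<in> L" for l using that by blast
  obtain Q where Q: "Q \<subseteq> P" "card Q = 4" "\<And>l. l \<in> L \<Longrightarrow> card (l \<inter> Q) \<le> 2"
    using quadrangle by blast
  \<comment> \<open>The point \<open>p\<close> may itself belong to the quadrangle, so only three
    points are certain.\<close>
  have "card (Q - {p}) \<ge> 3" using Q by (simp add: card_Diff_singleton_if)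
  then obtain Q' where "Q' \<subseteq> Q - {p}" "card Q' = 3" by (meson obtain_subset_with_card_n)
  then obtain a b c where abc: "{a, b, c} \<subseteq> Q - {p}" "a \<noteq> b" "a \<noteq> c" "b \<noteq> c"
    by (metis card_3_iff)
  have inP: "a \<in> P" "b \<in> P" "c \<in> P" using abc Q by auto
  obtain l where l: "l \<in> L" "a \<in> l" "b \<in> l" using unique_line[of a b] abc inP by blast
  obtain l' where l': "l' \<in> L" "a \<in> l'" "c \<in> l'" using unique_line[of a c] abc inP by blast
  have "l \<noteq> l'"
  proof
    assume "l = l'"
    then have "{a, b, c} \<subseteq> l \<inter> Q" using l l' abc by auto
    moreover have "finite (l \<inter> Q)" using finite_line l by simp
    ultimately have "card {a, b, c} \<le> card (l \<inter> Q)" by (rule card_mono[rotated])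
    then show False using Q(3)[OF l(1)] abc by simp
  qed
  then have "p = a" using unique_point[OF l(1) l'(1)] all[OF l(1)] all[OF l'(1)] l l' by blast
  then show False using abc by simp
qed

text \<open>Projection from \<open>p\<close> identifies the points of a line \<open>k\<close> that
  avoids \<open>p\<close> with the lines through \<open>p\<close>.\<close>

lemma card_lines_through:
  assumes p: "p \<in> P"
  shows "card {l\<in>L. p \<in> l} = n + 1"
proof -
  obtain k where k: "k \<in> L" "p \<notin> k" using ex_line_avoiding[OF p] by blast
  let ?f = "\<lambda>q. THE l. l \<in> L \<and> p \<in> l \<and> q \<in> l"
  have f: "?f q \<in> L" "p \<in> ?f q" "q \<in> ?f q" if "q \<in> k" for q
  proof -
    have "\<exists>!l. l \<in> L \<and> p \<in> l \<and> q \<in> l"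
      using that k p lines_subset by (intro unique_line) auto
    from theI'[OF this] show "?f q \<in> L" "p \<in> ?f q" "q \<in> ?f q" by auto
  qed
  have bij: "bij_betw ?f k {l\<in>L. p \<in> l}"
    unfolding bij_betw_def
  proof
    show "inj_on ?f k"
    proof (rule inj_onI)
      fix q r assume qr: "q \<in> k" "r \<in> k" "?f q = ?f r"
      have "?f q \<noteq> k" using f[OF qr(1)] k by blast
      then show "q = r" using unique_point[OF f(1)[OF qr(1)] k(1)] f[OF qr(1)] f[OF qr(2)] qr
        by metis
    qed
    show "?f ` k = {l\<in>L. p \<in> l}"
    proof
      show "?f ` k \<subseteq> {l\<in>L. p \<in> l}" using f by blast
      show "{l\<in>L. p \<in> l} \<subseteq> ?f ` k"
      proof
        fix l assume l: "l \<in> {l\<in>L. p \<in> l}"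
        then have "l \<noteq> k" using k by auto
        then obtain q where q: "q \<in> l" "q \<in> k" using unique_point[of l k] l k by auto
        have "\<exists>!l. l \<in> L \<and> p \<in> l \<and> q \<in> l"
          using q k p lines_subset by (intro unique_line) auto
        then have "?f q = l" using l q by (intro the1_equality) auto
        then show "l \<in> ?f ` k" using q by auto
      qed
    qed
  qed
  show ?thesis using bij_betw_same_card[OF bij] card_line[OF k(1)] by simp
qed

text \<open>The lines through a fixed point partition the remaining points.\<close>

lemma card_points: "card P = n\<^sup>2 + n + 1"
proof -
  obtain Q where Q: "Q \<subseteq> P" "card Q = 4" using quadrangle by blast
  then obtain p where p: "p \<in> P" by (metis card.empty ex_in_conv subset_empty zero_neq_numeral)
  let ?S = "{l\<in>L. p \<in> l}"
  have "P - {p} = (\<Union>l\<in>?S. l - {p})"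
  proof
    show "P - {p} \<subseteq> (\<Union>l\<in>?S. l - {p})"
    proof
      fix q assume "q \<in> P - {p}"
      then show "q \<in> (\<Union>l\<in>?S. l - {p})" using unique_line[of p q] p by blast
    qed
  qed (use lines_subset in blast)
  then have "card (P - {p}) = card (\<Union>l\<in>?S. l - {p})" by simp
  also have "\<dots> = (\<Sum>l\<in>?S. card (l - {p}))"
    using finite_lines finite_line common_point_unique[where p = p]
    by (intro card_UN_disjoint ballI impI equals0I) (simp_all, blast)
  also have "\<dots> = (\<Sum>l\<in>?S. n)" using card_line by (intro sum.cong) (auto simp: card_Diff_singleton_if)
  also have "\<dots> = (n + 1) * n" using card_lines_through[OF p] by simp
  finally have "card P - 1 = (n + 1) * n" using p by simp
  moreover have "card P > 0" using p finite_points by (auto simp: card_gt_0_iff)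
  ultimately show ?thesis by (simp add: power2_eq_square algebra_simps)
qed

text \<open>Double counting of incidences; \<open>X = P\<close> yields the number of lines.\<close>

lemma sum_card_inter:
  assumes "X \<subseteq> P"
  shows "(\<Sum>l\<in>L. card (l \<inter> X)) = (n + 1) * card X"
proof -
  have "finite X" using assms finite_points finite_subset by blast
  have "(\<Sum>l\<in>L. card (l \<inter> X)) = (\<Sum>l\<in>L. \<Sum>p\<in>X. if p \<in> l then 1 else 0)"
    using \<open>finite X\<close> by (intro sum.cong) (auto simp: sum.If_cases Int_commute Int_def)
  also have "\<dots> = (\<Sum>p\<in>X. \<Sum>l\<in>L. if p \<in> l then 1 else 0)" by (rule sum.swap)
  also have "\<dots> = (\<Sum>p\<in>X. card {l\<in>L. p \<in> l})"
    using finite_lines by (intro sum.cong) (auto simp: sum.If_cases Int_def)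
  also have "\<dots> = (\<Sum>p\<in>X. n + 1)" using assms card_lines_through by (intro sum.cong) auto
  finally show ?thesis by simp
qed

lemma card_lines: "card L = n\<^sup>2 + n + 1"
proof -
  have "(\<Sum>l\<in>L. card (l \<inter> P)) = (\<Sum>l\<in>L. n + 1)"
    using card_line lines_subset by (intro sum.cong) (auto simp: Int_absorb2)
  then have "card L * (n + 1) = (n\<^sup>2 + n + 1) * (n + 1)"
    using sum_card_inter[of P] card_points by (simp only: sum_constant of_nat_id mult.commute)
  then show ?thesis by (metis mult_cancel2 add_is_0 one_neq_zero)
qed

lemma order_ge_2: "n \<ge> 2"
proof -
  obtain Q where Q: "Q \<subseteq> P" "card Q = 4" using quadrangle by blast
  then have 4: "4 \<le> n\<^sup>2 + n + 1" using card_mono[OF finite_points Q(1)] card_points by simp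
  show ?thesis
  proof (rule ccontr)
    assume "\<not> n \<ge> 2"
    then consider "n = 0" | "n = 1" by linarith
    then show False using 4 by cases simp_all
  qed
qed

text \<open>Counts the lines through each ordered pair of points of \<open>X\<close>:
  \<open>n + 1\<close> if the two points coincide, one otherwise.\<close>

lemma sum_card_inter_squared:
  assumes "X \<subseteq> P"
  shows "(\<Sum>l\<in>L. (card (l \<inter> X))\<^sup>2) = n * card X + (card X)\<^sup>2"
proof -
  have finX: "finite X" using assms finite_points finite_subset by blast
  have "(\<Sum>l\<in>L. (card (l \<inter> X))\<^sup>2) = (\<Sum>l\<in>L. \<Sum>p\<in>X. if p \<in> l then card (l \<inter> X) else 0)"
  proof (intro sum.cong refl)
    fix l
    have "(\<Sum>p\<in>X. if p \<in> l then card (l \<inter> X) else 0) = card {p\<in>X. p \<in> l} * card (l \<inter> X)"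
      using finX by (simp add: sum.If_cases Int_def)
    also have "{p\<in>X. p \<in> l} = l \<inter> X" by auto
    finally show "(card (l \<inter> X))\<^sup>2 = (\<Sum>p\<in>X. if p \<in> l then card (l \<inter> X) else 0)"
      by (simp add: power2_eq_square)
  qed
  also have "\<dots> = (\<Sum>p\<in>X. \<Sum>l\<in>L. if p \<in> l then card (l \<inter> X) else 0)" by (rule sum.swap)
  also have "\<dots> = (\<Sum>p\<in>X. \<Sum>l\<in>{l\<in>L. p \<in> l}. card (l \<inter> X))"
    using finite_lines by (intro sum.cong[OF refl] sum.inter_filter[symmetric])
  also have "\<dots> = (\<Sum>p\<in>X. n + card X)"
  proof (intro sum.cong refl)
    fix p assume p: "p \<in> X"
    let ?S = "{l\<in>L. p \<in> l}"
    have "card (l \<inter> X) = 1 + card (l \<inter> (X - {p}))" if "l \<in> ?S" for l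
    proof -
      have "l \<inter> X = insert p (l \<inter> (X - {p}))" using that p by auto
      then show ?thesis using finX by simp
    qed
    then have "(\<Sum>l\<in>?S. card (l \<inter> X)) = (n + 1) + (\<Sum>l\<in>?S. card (l \<inter> (X - {p})))"
      using card_lines_through[of p] p assms by (simp add: sum_Suc subset_iff)
    also have "(\<Sum>l\<in>?S. card (l \<inter> (X - {p}))) = card (\<Union>l\<in>?S. l \<inter> (X - {p}))"
      using finite_lines finX common_point_unique[where p = p]
      by (intro card_UN_disjoint[symmetric] ballI impI equals0I) (simp_all, blast)
    also have "(\<Union>l\<in>?S. l \<inter> (X - {p})) = X - {p}"
    proof
      show "X - {p} \<subseteq> (\<Union>l\<in>?S. l \<inter> (X - {p}))"
      proof
        fix q assume q: "q \<in> X - {p}"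
        then show "q \<in> (\<Union>l\<in>?S. l \<inter> (X - {p}))" using unique_line[of p q] p assms by blast
      qed
    qed auto
    also have "(n + 1) + card (X - {p}) = n + card X"
      using card_Suc_Diff1[OF finX p] by simp
    finally show "(\<Sum>l\<in>?S. card (l \<inter> X)) = n + card X" .
  qed
  finally show ?thesis by (simp add: power2_eq_square algebra_simps)
qed

end

section \<open>Legitimate colorings of projective planes\<close>

text \<open>Applied to \<open>l - l'\<close> and \<open>l' - l\<close>, which amounts to equality of
  the line types: the common point contributes equally to both. These two sets are disjoint, so one
  can be recolored without touching the other.\<close>

definition balanced :: "nat \<Rightarrow> ('p \<Rightarrow> nat) \<Rightarrow> 'p set \<Rightarrow> 'p set \<Rightarrow> bool" where
  "balanced c g X Y \<longleftrightarrow> (\<forall>i\<in>{1..c}. card {p\<in>X. g p = i} = card {p\<in>Y. g p = i})"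

text \<open>Recoloring \<open>A\<close> leaves \<open>Y\<close> and \<open>X - A\<close> unchanged,
  so balance prescribes how often each color occurs on \<open>A\<close>.\<close>

lemma card_balanced_extensions_le:
  fixes X Y :: "'p set"
  assumes fin: "finite X" and A: "A \<subseteq> X" "A \<subseteq> T" "A \<inter> Y = {}"
    and K: "\<And>t. card {u \<in> A \<rightarrow>\<^sub>E {1..c}. \<forall>i\<in>{1..c}. card {p\<in>A. u p = i} = t i} \<le> K"
  shows "card {u \<in> A \<rightarrow>\<^sub>E {1..c}. balanced c (override_on f (override_on h u A) T) X Y} \<le> K"
proof -
  let ?g = "override_on f h T"
  \<comment> \<open>The truncated subtraction is exact whenever the coloring is balanced.\<close>
  define t where "t = (\<lambda>i. card {p\<in>Y. ?g p = i} - card {p\<in>X-A. ?g p = i})"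
  have "{u \<in> A \<rightarrow>\<^sub>E {1..c}. balanced c (override_on f (override_on h u A) T) X Y}
      \<subseteq> {u \<in> A \<rightarrow>\<^sub>E {1..c}. \<forall>i\<in>{1..c}. card {p\<in>A. u p = i} = t i}"
  proof clarify
    fix u i assume bal: "balanced c (override_on f (override_on h u A) T) X Y" and i: "i \<in> {1..c}"
    let ?gu = "override_on f (override_on h u A) T"
    have gu: "?gu p = (if p \<in> A then u p else ?g p)" for p using A by (auto simp: override_on_def)
    have "{p\<in>X. ?gu p = i} = {p\<in>A. u p = i} \<union> {p\<in>X-A. ?g p = i}"
      unfolding gu using A by auto
    then have "card {p\<in>X. ?gu p = i} = card {p\<in>A. u p = i} + card {p\<in>X-A. ?g p = i}"
      using fin finite_subset[OF A(1) fin] by (simp add: card_Un_disjoint disjoint_iff)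
    moreover have "{p\<in>Y. ?gu p = i} = {p\<in>Y. ?g p = i}" unfolding gu using A(3) by auto
    ultimately show "card {p\<in>A. u p = i} = t i" using bal i by (simp add: balanced_def t_def)
  qed
  moreover have "finite {u \<in> A \<rightarrow>\<^sub>E {1..c}. \<forall>i\<in>{1..c}. card {p\<in>A. u p = i} = t i}"
    using finite_PiE[OF finite_subset[OF A(1) fin], of "\<lambda>_. {1..c}"] by simp
  ultimately show ?thesis by (intro order_trans[OF card_mono K])
qed

text \<open>A bound independent of the number of colors: prescribed counts determine the coloring up
  to the order of the points.\<close>

lemma card_colorings_le_fact:
  fixes c :: nat
  assumes "finite A"
  shows "card {u \<in> A \<rightarrow>\<^sub>E {1..c}. \<forall>i\<in>{1..c}. card {p\<in>A. u p = i} = t i} \<le> fact (card A)"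
    (is "?k \<le> _")
proof -
  have "1 \<le> (\<Prod>i\<in>{1..c}. fact (t i) :: nat)" by (intro prod_ge_1) auto
  then have "?k * 1 \<le> ?k * (\<Prod>i\<in>{1..c}. fact (t i))" by (rule mult_left_mono) simp
  also have "\<dots> \<le> fact (card A)"
    by (rule card_colorings_with_counts[OF assms finite_atLeastAtMost])
  finally show ?thesis by simp
qed

lemma card_colorings_le_multinomial:
  assumes "finite A" "card A = q * c"
  shows "card {u \<in> A \<rightarrow>\<^sub>E {1..c}. \<forall>i\<in>{1..c}. card {p\<in>A. u p = i} = t i} \<le> fact (q * c) div fact q ^ c"
    (is "card ?U \<le> _")
proof (cases "?U = {}")
  case True
  then show ?thesis by (metis card.empty zero_le)
next
  case False
  then obtain u where u: "u \<in> ?U" by blast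
  have "(\<Sum>i\<in>{1..c}. t i) = (\<Sum>i\<in>{1..c}. card {p\<in>A. u p = i})" using u by simp
  also have "\<dots> = card (\<Union>i\<in>{1..c}. {p\<in>A. u p = i})"
    using assms(1) by (intro card_UN_disjoint[symmetric]) auto
  also have "(\<Union>i\<in>{1..c}. {p\<in>A. u p = i}) = A" using u by auto
  finally have "fact q ^ card {1..c} \<le> (\<Prod>i\<in>{1..c}. fact (t i) :: nat)"
    using assms(2) by (intro prod_fact_ge_balanced) auto
  then have "card ?U * fact q ^ c \<le> card ?U * (\<Prod>i\<in>{1..c}. fact (t i))" by simp
  also have "\<dots> \<le> fact (q * c)"
    using card_colorings_with_counts[OF assms(1) finite_atLeastAtMost, of 1 c t] assms(2) by simp
  finally show ?thesis by (simp add: less_eq_div_iff_mult_less_eq)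
qed

section \<open>Legitimate colorings from the union bound and from the counting method\<close>

lemma legitimate_coloring_mono:
  assumes "legitimate_coloring P L c g" "c \<le> c'"
  shows "legitimate_coloring P L c' g"
proof -
  have "line_type c P g l = line_type c P g l'" if eq: "line_type c' P g l = line_type c' P g l'" for l l'
  proof -
    have "card {p \<in> l \<inter> P. g p = i} = card {p \<in> l' \<inter> P. g p = i}" if "i \<in> {1..c}" for i
      using fun_cong[OF eq, of i] that assms(2) by (simp add: line_type_def)
    then show ?thesis unfolding line_type_def by (intro restrict_ext) auto
  qed
  moreover have "g \<in> P \<rightarrow> {1..c'}" using assms unfolding legitimate_coloring_def by force
  ultimately show ?thesis using assms(1) unfolding legitimate_coloring_def by blast
qed

context projective_plane
begin

abbreviation "line_pairs \<equiv> {D. D \<subseteq> L \<and> card D = 2}"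

lemma line_pairsE:
  assumes "D \<in> line_pairs"
  obtains l l' where "D = {l, l'}" "l \<in> L" "l' \<in> L" "l \<noteq> l'"
  using assms by (auto simp: card_2_iff)

lemma finite_line_pairs: "finite line_pairs"
  by (rule finite_subset[of _ "Pow L"]) (auto simp: finite_lines)

lemma card_line_pairs: "card line_pairs = (n\<^sup>2 + n + 1) choose 2"
  using n_subsets[OF finite_lines, of 2] card_lines by simp

lemma balanced_if_line_type_eq:
  assumes "l \<in> L" "l' \<in> L" and eq: "line_type c P g l = line_type c P g l'"
  shows "balanced c g (l - l') (l' - l)"
  unfolding balanced_def
proof
  fix i assume i: "i \<in> {1..c}"
  have split: "card {p\<in>k. g p = i} = card {p\<in>k-k'. g p = i} + card {p\<in>k\<inter>k'. g p = i}" if "finite k" for k k'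
  proof -
    have "{p\<in>k. g p = i} = {p\<in>k-k'. g p = i} \<union> {p\<in>k\<inter>k'. g p = i}" by auto
    then show ?thesis using that by (simp add: card_Un_disjoint disjoint_iff)
  qed
  have "l \<inter> P = l" "l' \<inter> P = l'" using lines_subset assms by blast+
  then have "card {p\<in>l. g p = i} = card {p\<in>l'. g p = i}"
    using fun_cong[OF eq, of i] i by (simp add: line_type_def)
  then show "card {p\<in>l-l'. g p = i} = card {p\<in>l'-l. g p = i}"
    using split[of l l'] split[of l' l] finite_line assms by (simp add: Int_commute)
qed

lemma legitimate_if_unbalanced:
  assumes "g \<in> P \<rightarrow> {1..c}"
    and "\<And>l l'. l \<in> L \<Longrightarrow> l' \<in> L \<Longrightarrow> l \<noteq> l' \<Longrightarrow> \<not> balanced c g (l - l') (l' - l)"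
  shows "legitimate_coloring P L c g"
  unfolding legitimate_coloring_def
proof (intro conjI ballI impI notI assms(1))
  fix l l' assume l: "l \<in> L" "l' \<in> L" "l \<noteq> l'" "line_type c P g l = line_type c P g l'"
  show False by (rule notE[OF assms(2)[OF l(1-3)] balanced_if_line_type_eq[OF l(1,2,4)]])
qed

text \<open>The union bound over all pairs of lines, with \<open>A\<close> inside
  \<open>l - l'\<close>; this set has \<open>n\<close> points, hence
  \<open>r \<le> n\<close>.\<close>

lemma legitimate_coloring_if_few_pairs:
  assumes r: "r \<le> n" and c: "c > 0"
    and K: "\<And>(A :: 'p set) t. finite A \<Longrightarrow> card A = r \<Longrightarrow>
      card {u \<in> A \<rightarrow>\<^sub>E {1..c}. \<forall>i\<in>{1..c}. card {p\<in>A. u p = i} = t i} \<le> K"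
    and less: "((n\<^sup>2 + n + 1) choose 2) * K < c ^ r"
  shows "\<exists>g. legitimate_coloring P L c g"
proof -
  \<comment> \<open>Quantifying over both orders makes this a property of the unordered pair. The
    instances with \<open>l = l'\<close> compare empty sets and hold trivially.\<close>
  define bad where "bad = (\<lambda>D h. \<forall>l\<in>D. \<forall>l'\<in>D. balanced c (override_on (\<lambda>_. 0) h P) (l - l') (l' - l))"
  have "\<exists>h\<in>P \<rightarrow>\<^sub>E {1..c}. \<forall>D\<in>line_pairs. \<not> bad D h"
  proof (rule union_bound_coloring[where r = r and K = K])
    fix D assume "D \<in> line_pairs"
    then obtain l l' where D: "D = {l, l'}" "l \<in> L" "l' \<in> L" "l \<noteq> l'" by (rule line_pairsE)
    obtain A where A: "A \<subseteq> l - l'" "card A = r"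
      using obtain_subset_with_card_n[of r "l - l'"] card_Diff_lines D r by metis
    have finA: "finite A" using finite_subset[OF A(1)] finite_line[OF D(2)] by simp
    have AP: "A \<subseteq> P" using A lines_subset D by blast
    have "card {u \<in> A \<rightarrow>\<^sub>E {1..c}. bad D (override_on h u A)} \<le> K" for h
    proof -
      have "card {u \<in> A \<rightarrow>\<^sub>E {1..c}. bad D (override_on h u A)} \<le>
          card {u \<in> A \<rightarrow>\<^sub>E {1..c}. balanced c (override_on (\<lambda>_. 0) (override_on h u A) P) (l - l') (l' - l)}"
      proof (rule card_mono)
        show "finite {u \<in> A \<rightarrow>\<^sub>E {1..c}. balanced c (override_on (\<lambda>_. 0) (override_on h u A) P) (l - l') (l' - l)}"
          using finA by (simp add: finite_PiE)
      qed (simp add: bad_def D Collect_mono)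
      also have "\<dots> \<le> K"
        using A AP K[OF finA] D finite_line by (intro card_balanced_extensions_le) auto
      finally show ?thesis .
    qed
    then show "\<exists>A\<subseteq>P. card A = r \<and> (\<forall>h. card {u \<in> A \<rightarrow>\<^sub>E {1..c}. bad D (override_on h u A)} \<le> K)"
      using A AP by blast
  qed (use finite_points finite_line_pairs c less in \<open>simp_all add: card_line_pairs\<close>)
  then obtain h where h: "h \<in> P \<rightarrow>\<^sub>E {1..c}" "\<And>D. D \<in> line_pairs \<Longrightarrow> \<not> bad D h" by blast
  let ?g = "override_on (\<lambda>_. 0) h P"
  have "\<not> balanced c ?g (l - l') (l' - l)" if "l \<in> L" "l' \<in> L" "l \<noteq> l'" for l l'
  proof
    assume "balanced c ?g (l - l') (l' - l)"
    then have "bad {l, l'} h" unfolding bad_def by (auto simp: balanced_def)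
    then show False using h(2)[of "{l, l'}"] that by auto
  qed
  moreover have "?g \<in> P \<rightarrow> {1..c}" using h(1) by auto
  ultimately show ?thesis using legitimate_if_unbalanced by blast
qed

lemma legitimate_coloring_if_fact_less:
  assumes "((n\<^sup>2 + n + 1) choose 2) * fact n < c ^ n"
  shows "\<exists>g. legitimate_coloring P L c g"
proof (rule legitimate_coloring_if_few_pairs[of n])
  show "c > 0" using assms order_ge_2 by (cases "c = 0") (auto simp: power_0_left)
qed (use assms card_colorings_le_fact in auto)

text \<open>The probability that the colors of \<open>q * c\<close> points have prescribed counts is
  largest for equal counts. Squaring avoids the half-integral exponent
  \<open>(c - 1) / 2\<close>.\<close>

lemma legitimate_coloring_if_multinomial_less:
  assumes c: "c \<ge> 5" and q: "q * c \<le> n"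
    and less: "((n\<^sup>2 + n + 1) choose 2)\<^sup>2 < (4 * q + 1) ^ (c - 1)"
  shows "\<exists>g. legitimate_coloring P L c g"
proof (rule legitimate_coloring_if_few_pairs[OF q])
  let ?N = "(n\<^sup>2 + n + 1) choose 2"
  let ?K = "fact (q * c) div fact q ^ c :: nat"
  show "c > 0" using c by simp
  show "card {u \<in> A \<rightarrow>\<^sub>E {1..c}. \<forall>i\<in>{1..c}. card {p\<in>A. u p = i} = t i} \<le> ?K"
    if "finite A" "card A = q * c" for A :: "'p set" and t
    using that by (rule card_colorings_le_multinomial)
  define p where "p = fact (q * c) / (fact q ^ c * real c ^ (q * c))"
  have p: "p > 0" "p\<^sup>2 * real (4 * q + 1) ^ (c - 1) \<le> 1"
    using balanced_multinomial_bound[OF c, of q] c unfolding p_def by auto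
  have "real ?K \<le> real (fact (q * c)) / real (fact q ^ c)" by (rule of_nat_div_le_of_nat)
  also have "\<dots> = p * real c ^ (q * c)" using c by (simp add: p_def)
  finally have "real (?N * ?K) \<le> real ?N * (p * real c ^ (q * c))"
    unfolding of_nat_mult by (intro mult_left_mono) auto
  also have "\<dots> < real c ^ (q * c)"
  proof -
    have "(real ?N)\<^sup>2 < real (4 * q + 1) ^ (c - 1)"
      using less by (metis of_nat_less_iff of_nat_power)
    then have "(real ?N)\<^sup>2 * p\<^sup>2 < real (4 * q + 1) ^ (c - 1) * p\<^sup>2"
      using p(1) by (intro mult_strict_right_mono) auto
    then have "(real ?N * p)\<^sup>2 < 1\<^sup>2" using p(2) by (simp add: power_mult_distrib mult.commute)
    then have "real ?N * p < 1" by (rule power2_less_imp_less) simp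
    then have "(real ?N * p) * real c ^ (q * c) < 1 * real c ^ (q * c)"
      using c by (intro mult_strict_right_mono) auto
    then show ?thesis by (simp add: mult.assoc)
  qed
  finally show "?N * ?K < c ^ (q * c)" by (simp only: of_nat_less_iff flip: of_nat_power)
qed

text \<open>\<open>T\<close> is the set that gets colored: \<open>S\<close> for large orders, all of
  \<open>P\<close> for small ones.\<close>

lemma rosenfeld_plane_coloring:
  assumes T: "T \<subseteq> P" and f: "f \<in> P - T \<rightarrow> {1..c}"
    and Ds: "\<D> \<subseteq> line_pairs" and deg: "\<And>v. v \<in> P \<Longrightarrow> card {D\<in>\<D>. v \<in> \<Union>D} \<le> q"
    and m: "m \<ge> 1" "\<And>l l'. l \<in> L \<Longrightarrow> l' \<in> L \<Longrightarrow> l \<noteq> l' \<Longrightarrow> m \<le> card ((l - l') \<inter> T)"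
    and \<beta>: "\<beta> > 0" "\<beta> + real q * fact m / \<beta> ^ (m - 1) \<le> real c"
  shows "\<exists>g\<in>P \<rightarrow> {1..c}. (\<forall>p\<in>P - T. g p = f p) \<and>
    (\<forall>l l'. {l, l'} \<in> \<D> \<longrightarrow> \<not> balanced c g (l - l') (l' - l))"
proof -
  define bad where "bad = (\<lambda>D h. \<forall>l\<in>D. \<forall>l'\<in>D. balanced c (override_on f h T) (l - l') (l' - l))"
  \<comment> \<open>The symmetric difference of the two lines, within \<open>T\<close>. Their common
    point is left out because \<open>bad\<close> does not depend on its color.\<close>
  define supp where "supp = (\<lambda>D. (\<Union>D - \<Inter>D) \<inter> T)"
  have supp: "supp {l, l'} = ((l - l') \<union> (l' - l)) \<inter> T" for l l' unfolding supp_def by auto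
  have finD: "finite \<D>" by (rule finite_subset[OF Ds finite_line_pairs])
  have pair: "\<exists>l l'. D = {l, l'} \<and> l \<in> L \<and> l' \<in> L \<and> l \<noteq> l'" if "D \<in> \<D>" for D
  proof -
    have "D \<in> line_pairs" using that Ds by (rule rev_subsetD)
    then show ?thesis by (elim line_pairsE) auto
  qed
  have "\<exists>h\<in>T \<rightarrow>\<^sub>E {1..c}. \<forall>D\<in>\<D>. \<not> bad D h"
  proof (rule rosenfeld_counting_coloring[where supp = supp and q = q and m = m and K = "fact m" and \<beta> = \<beta>])
    fix D assume D: "D \<in> \<D>"
    obtain l l' where l: "D = {l, l'}" "l \<in> L" "l' \<in> L" "l \<noteq> l'" using pair[OF D] by blast
    have "(l - l') \<inter> T \<noteq> {}" using m(1) m(2)[OF l(2-4)] by auto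
    then show "supp D \<subseteq> T \<and> supp D \<noteq> {}" unfolding l(1) supp by blast
    show "bad D h = bad D h'" if eq: "\<And>p. p \<in> supp D \<Longrightarrow> h p = h' p" for h h'
    proof -
      have "override_on f h T p = override_on f h' T p" if "p \<in> (l - l') \<union> (l' - l)" for p
        using eq[of p] that unfolding l(1) supp by (auto simp: override_on_def)
      then have "{p\<in>k-k'. override_on f h T p = i} = {p\<in>k-k'. override_on f h' T p = i}"
        if "k \<in> D" "k' \<in> D" for k k' i
        using that unfolding l(1) by auto
      then show ?thesis unfolding bad_def balanced_def by simp
    qed
    fix v assume v: "v \<in> supp D"
    \<comment> \<open>The two lines play symmetric parts: the \<open>m\<close> points are taken from
      the line that contains \<open>v\<close>.\<close>
    have main: "\<exists>A\<subseteq>supp D. v \<in> A \<and> card A = m \<and>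
        (\<forall>h. card {u \<in> A \<rightarrow>\<^sub>E {1..c}. bad D (override_on h u A)} \<le> fact m)"
      if k: "D = {k, k'}" "k \<in> L" "k' \<in> L" "k \<noteq> k'" and v: "v \<in> (k - k') \<inter> T" for k k'
    proof -
      have fink: "finite k" using finite_line k by blast
      have "m - 1 \<le> card ((k - k') \<inter> T - {v})" using m(2)[OF k(2-4)] v by simp
      then obtain A' where A': "A' \<subseteq> (k - k') \<inter> T - {v}" "card A' = m - 1" "finite A'"
        by (rule obtain_subset_with_card_n)
      define A where "A = insert v A'"
      have A: "A \<subseteq> (k - k') \<inter> T" "v \<in> A" "card A = m" "finite A"
      proof -
        have "v \<notin> A'" using A'(1) by auto
        then show "card A = m" using A' m(1) by (simp add: A_def)
      qed (use A' v in \<open>auto simp: A_def\<close>)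
      have "card {u \<in> A \<rightarrow>\<^sub>E {1..c}. bad D (override_on h u A)} \<le> fact m" for h
      proof -
        have "card {u \<in> A \<rightarrow>\<^sub>E {1..c}. bad D (override_on h u A)} \<le>
            card {u \<in> A \<rightarrow>\<^sub>E {1..c}. balanced c (override_on f (override_on h u A) T) (k - k') (k' - k)}"
        proof (rule card_mono)
          show "finite {u \<in> A \<rightarrow>\<^sub>E {1..c}. balanced c (override_on f (override_on h u A) T) (k - k') (k' - k)}"
            using A by (simp add: finite_PiE)
        qed (simp add: bad_def k Collect_mono)
        also have "\<dots> \<le> fact m"
          using A card_colorings_le_fact[of A] fink by (intro card_balanced_extensions_le) auto
        finally show ?thesis .
      qed
      moreover have "A \<subseteq> supp D" using A unfolding k(1) supp by blast
      ultimately show ?thesis using A by blast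
    qed
    show "\<exists>A\<subseteq>supp D. v \<in> A \<and> card A = m \<and>
        (\<forall>h. card {u \<in> A \<rightarrow>\<^sub>E {1..c}. bad D (override_on h u A)} \<le> fact m)"
    proof (cases "v \<in> l")
      case True
      then show ?thesis using v l by (intro main[of l l']) (auto simp: supp)
    next
      case False
      then show ?thesis using v l by (intro main[of l' l]) (auto simp: supp)
    qed
  next
    fix v assume "v \<in> T"
    then have "v \<in> P" using T by blast
    have "card {D\<in>\<D>. v \<in> supp D} \<le> card {D\<in>\<D>. v \<in> \<Union>D}"
      using finD by (intro card_mono) (auto simp: supp_def)
    then show "card {D\<in>\<D>. v \<in> supp D} \<le> q" using deg[OF \<open>v \<in> P\<close>] by simp
  qed (use finite_subset[OF T finite_points] finD \<beta> in auto)
  then obtain h where h: "h \<in> T \<rightarrow>\<^sub>E {1..c}" "\<And>D. D \<in> \<D> \<Longrightarrow> \<not> bad D h" by blast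
  let ?g = "override_on f h T"
  have "?g p \<in> {1..c}" if "p \<in> P" for p
    using h(1) f that by (cases "p \<in> T") auto
  moreover have "\<not> balanced c ?g (l - l') (l' - l)" if "{l, l'} \<in> \<D>" for l l'
  proof
    assume "balanced c ?g (l - l') (l' - l)"
    then have "bad {l, l'} h" unfolding bad_def by (auto simp: balanced_def)
    then show False using h(2) that by blast
  qed
  ultimately show ?thesis by (intro bexI[of _ ?g]) auto
qed

end

section \<open>Dangerous pairs and the variance of line types\<close>

context projective_plane
begin

lemma dangerous_pairs_subset: "dangerous_pairs P L n S c f \<subseteq> line_pairs"
  unfolding dangerous_pairs_def by (auto simp: card_2_iff)

lemma line_type_outside:
  "i \<in> {1..c} \<Longrightarrow> line_type c (P - S) f l i = card (l \<inter> {p\<in>P-S. f p = i})"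
  unfolding line_type_def by (simp, rule arg_cong[of _ _ card], auto)

text \<open>Cauchy-Schwarz over the \<open>d\<close> colors reduces the claim to the variance of
  \<open>card (l \<inter> X i)\<close> for each color class. The classes are disjoint, and there are
  as many points as lines.\<close>

lemma sum_squared_l1_dist_le:
  fixes d :: nat and f :: "'p \<Rightarrow> nat"
  assumes "S \<subseteq> P"
  defines "t \<equiv> line_type d (P - S) f"
  shows "(\<Sum>l\<in>L. \<Sum>l'\<in>L. (real_of_int (l1_dist d (t l) (t l')))\<^sup>2)
    \<le> 2 * real d * real n * (real (card L))\<^sup>2"
proof -
  let ?N = "real (card L)"
  define X where "X = (\<lambda>i. {p\<in>P-S. f p = i})"
  define x where "x = (\<lambda>i l. real (card (l \<inter> X i)))"
  have N: "?N = (real n)\<^sup>2 + real n + 1" using card_lines by simp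
  have XP: "X i \<subseteq> P" for i unfolding X_def by auto
  have tx: "real (t l i) = x i l" if "i \<in> {1..d}" for i l
    unfolding t_def x_def X_def using line_type_outside[OF that] by simp
  have "(real_of_int (l1_dist d (t l) (t l')))\<^sup>2 \<le> real d * (\<Sum>i\<in>{1..d}. (x i l - x i l')\<^sup>2)" for l l'
  proof -
    have "real_of_int (l1_dist d (t l) (t l')) = (\<Sum>i\<in>{1..d}. \<bar>x i l - x i l'\<bar>)"
      unfolding l1_dist_def of_int_sum by (intro sum.cong refl) (simp flip: tx)
    then show ?thesis
      using sum_squared_le_sum_of_squares[of "\<lambda>i. \<bar>x i l - x i l'\<bar>" "{1..d}"] by (simp add: mult.commute)
  qed
  then have "(\<Sum>l\<in>L. \<Sum>l'\<in>L. (real_of_int (l1_dist d (t l) (t l')))\<^sup>2)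
      \<le> (\<Sum>l\<in>L. \<Sum>l'\<in>L. real d * (\<Sum>i\<in>{1..d}. (x i l - x i l')\<^sup>2))"
    by (intro sum_mono)
  also have "\<dots> = real d * (\<Sum>l\<in>L. \<Sum>i\<in>{1..d}. \<Sum>l'\<in>L. (x i l - x i l')\<^sup>2)"
    unfolding sum_distrib_left by (intro sum.cong refl sum.swap)
  also have "\<dots> = real d * (\<Sum>i\<in>{1..d}. \<Sum>l\<in>L. \<Sum>l'\<in>L. (x i l - x i l')\<^sup>2)"
    by (rule arg_cong[OF sum.swap])
  also have "\<dots> \<le> real d * (\<Sum>i\<in>{1..d}. 2 * ?N * real n * real (card (X i)))"
  proof (intro mult_left_mono sum_mono)
    fix i
    let ?s = "real (card (X i))"
    have 1: "(\<Sum>l\<in>L. x i l) = (real n + 1) * ?s"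
      using arg_cong[OF sum_card_inter[OF XP[of i]], of real] by (simp add: x_def algebra_simps)
    have 2: "(\<Sum>l\<in>L. (x i l)\<^sup>2) = real n * ?s + ?s\<^sup>2"
      using arg_cong[OF sum_card_inter_squared[OF XP[of i]], of real] by (simp add: x_def)
    have inner: "(\<Sum>l'\<in>L. (x i l - x i l')\<^sup>2)
        = ?N * (x i l)\<^sup>2 - 2 * (x i l * (\<Sum>l'\<in>L. x i l')) + (\<Sum>l'\<in>L. (x i l')\<^sup>2)" for l
      unfolding power2_diff by (simp add: sum.distrib sum_subtractf sum_distrib_left mult_ac)
    have "(\<Sum>l\<in>L. \<Sum>l'\<in>L. (x i l - x i l')\<^sup>2)
        = ?N * (\<Sum>l\<in>L. (x i l)\<^sup>2) - 2 * ((\<Sum>l\<in>L. x i l) * (\<Sum>l'\<in>L. x i l')) + ?N * (\<Sum>l'\<in>L. (x i l')\<^sup>2)"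
      unfolding inner by (simp add: sum.distrib sum_subtractf flip: sum_distrib_left sum_distrib_right)
    also have "\<dots> = 2 * ?N * real n * ?s - 2 * real n * ?s\<^sup>2"
      unfolding 1 2 N by (simp add: power2_eq_square algebra_simps)
    finally show "(\<Sum>l\<in>L. \<Sum>l'\<in>L. (x i l - x i l')\<^sup>2) \<le> 2 * ?N * real n * ?s" by simp
  qed simp
  also have "\<dots> = 2 * real d * real n * ?N * real (\<Sum>i\<in>{1..d}. card (X i))"
    by (simp add: sum_distrib_left mult_ac)
  also have "(\<Sum>i\<in>{1..d}. card (X i)) = card (\<Union>i\<in>{1..d}. X i)"
    using finite_points by (intro card_UN_disjoint[symmetric]) (auto simp: X_def)
  also have "2 * real d * real n * ?N * real (card (\<Union>i\<in>{1..d}. X i)) \<le> 2 * real d * real n * ?N * ?N"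
  proof (intro mult_left_mono)
    have "card (\<Union>i\<in>{1..d}. X i) \<le> card P" using XP finite_points by (intro card_mono) auto
    then show "real (card (\<Union>i\<in>{1..d}. X i)) \<le> ?N"
      by (simp only: card_points card_lines of_nat_le_iff)
  qed simp
  finally show ?thesis by (simp add: power2_eq_square mult.assoc)
qed

text \<open>Ordered pairs match the double sum over \<open>L\<close> in the variance
  estimate.\<close>

definition ordered_dangerous :: "'p set \<Rightarrow> nat \<Rightarrow> ('p \<Rightarrow> nat) \<Rightarrow> ('p set \<times> 'p set) set" where
  "ordered_dangerous S d f = {(l, l') \<in> L \<times> L. l \<noteq> l' \<and>
    real_of_int (l1_dist d (line_type d (P - S) f l) (line_type d (P - S) f l')) \<le> 22 * ln (real n)}"

lemma finite_ordered_dangerous: "finite (ordered_dangerous S d f)"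
  unfolding ordered_dangerous_def using finite_lines by (rule_tac finite_subset[of _ "L \<times> L"]) auto

text \<open>Double counting of points on dangerous pairs: each pair covers \<open>2 * n + 1\<close>
  points, and the factor 2 accounts for the two orders.\<close>

lemma card_ordered_dangerous_le:
  assumes deg: "\<And>p. p \<in> P \<Longrightarrow> card {D \<in> dangerous_pairs P L n S d f. p \<in> \<Union>D} \<le> q"
  shows "card (ordered_dangerous S d f) * (2 * n + 1) \<le> 2 * q * card L"
proof -
  let ?O = "ordered_dangerous S d f"
  let ?D = "dangerous_pairs P L n S d f"
  have finD: "finite ?D" by (rule finite_subset[OF dangerous_pairs_subset finite_line_pairs])
  have "card ?O * (2 * n + 1) = (\<Sum>x\<in>?O. card (fst x \<union> snd x))"
    by (simp add: ordered_dangerous_def card_Un_lines split_beta)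
  also have "\<dots> = (\<Sum>x\<in>?O. \<Sum>p\<in>P. if p \<in> fst x \<union> snd x then 1 else 0)"
  proof (intro sum.cong refl)
    fix x assume "x \<in> ?O"
    then have "fst x \<subseteq> P" "snd x \<subseteq> P"
      unfolding ordered_dangerous_def by (auto simp del: subset_iff dest!: lines_subset)
    then have "fst x \<union> snd x = {p\<in>P. p \<in> fst x \<union> snd x}" by auto
    then show "card (fst x \<union> snd x) = (\<Sum>p\<in>P. if p \<in> fst x \<union> snd x then 1 else 0)"
      using finite_points by (simp add: sum.If_cases Int_def)
  qed
  also have "\<dots> = (\<Sum>p\<in>P. \<Sum>x\<in>?O. if p \<in> fst x \<union> snd x then 1 else 0)" by (rule sum.swap)
  also have "\<dots> = (\<Sum>p\<in>P. card {x\<in>?O. p \<in> fst x \<union> snd x})"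
    using finite_ordered_dangerous[of S d f] by (intro sum.cong refl) (simp add: sum.If_cases Int_def)
  also have "\<dots> \<le> (\<Sum>p\<in>P. 2 * q)"
  proof (intro sum_mono)
    fix p assume p: "p \<in> P"
    let ?Dp = "{D \<in> ?D. p \<in> \<Union>D}"
    have two: "card {x\<in>?O. {fst x, snd x} = D} \<le> 2" for D
    proof (cases "{x\<in>?O. {fst x, snd x} = D} = {}")
      case True
      show ?thesis unfolding True by simp
    next
      case False
      then obtain k k' where "D = {k, k'}" by auto
      then have "{x\<in>?O. {fst x, snd x} = D} \<subseteq> {(k, k'), (k', k)}"
        by (auto simp: doubleton_eq_iff)
      then have "card {x\<in>?O. {fst x, snd x} = D} \<le> card {(k, k'), (k', k)}" by (rule card_mono[rotated]) simp
      also have "\<dots> \<le> 2" using card_length[of "[(k, k'), (k', k)]"] by simp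
      finally show ?thesis .
    qed
    have "{x\<in>?O. p \<in> fst x \<union> snd x} \<subseteq> (\<Union>D\<in>?Dp. {x\<in>?O. {fst x, snd x} = D})"
    proof
      fix x assume x: "x \<in> {x\<in>?O. p \<in> fst x \<union> snd x}"
      obtain l l' where l: "x = (l, l')" by (rule prod.exhaust)
      then have "{l, l'} \<in> ?D" using x unfolding ordered_dangerous_def dangerous_pairs_def by blast
      then have "{fst x, snd x} \<in> ?D" using l by simp
      with x show "x \<in> (\<Union>D\<in>?Dp. {x\<in>?O. {fst x, snd x} = D})" by auto
    qed
    then have "card {x\<in>?O. p \<in> fst x \<union> snd x} \<le> card (\<Union>D\<in>?Dp. {x\<in>?O. {fst x, snd x} = D})"
      using finD finite_ordered_dangerous by (intro card_mono) auto
    also have "\<dots> \<le> (\<Sum>D\<in>?Dp. card {x\<in>?O. {fst x, snd x} = D})" using finD by (intro card_UN_le) auto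
    also have "\<dots> \<le> (\<Sum>D\<in>?Dp. 2)" using two by (intro sum_mono)
    also have "\<dots> \<le> 2 * q" using deg[OF p] by simp
    finally show "card {x\<in>?O. p \<in> fst x \<union> snd x} \<le> 2 * q" .
  qed
  also have "\<dots> = 2 * q * card L" by (simp add: card_points card_lines)
  finally show ?thesis .
qed

text \<open>Few pairs are dangerous because \<open>q\<close> is small; all others are at distance
  more than \<open>22 * ln n\<close>, which forces a large mean square. The constant 474 is 98
  percent of \<open>22^2\<close>, rounded down.\<close>

lemma variance_bound:
  assumes "S \<subseteq> P" and n: "n \<ge> 40" and q: "q \<le> 661"
    and deg: "\<And>p. p \<in> P \<Longrightarrow> card {D \<in> dangerous_pairs P L n S d f. p \<in> \<Union>D} \<le> q"
  shows "474 * (ln (real n))\<^sup>2 \<le> 2 * real d * real n"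
proof -
  let ?O = "ordered_dangerous S d f"
  let ?N = "real (card L)"
  let ?d = "\<lambda>l l'. real_of_int (l1_dist d (line_type d (P - S) f l) (line_type d (P - S) f l'))"
  have "40 * 40 \<le> n * n" using n by (intro mult_mono) auto
  then have "1641 \<le> card L" using n by (simp add: card_lines power2_eq_square)
  then have N: "?N \<ge> 1641" by simp
  define A where "A = {(l, l') \<in> L \<times> L. l \<noteq> l'}"
  have cardA: "real (card A) = ?N * ?N - ?N"
  proof -
    have "A = L \<times> L - (\<lambda>l. (l, l)) ` L" unfolding A_def by auto
    moreover have "card ((\<lambda>l. (l, l)) ` L) = card L" by (intro card_image inj_onI) simp
    ultimately have "card A = card L * card L - card L"
      using finite_lines by (simp add: card_Diff_subset card_cartesian_product image_subset_iff)
    moreover have "card L \<le> card L * card L" by simp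
    ultimately show ?thesis by (simp add: of_nat_diff)
  qed
  have finA: "finite A" unfolding A_def using finite_lines by (rule_tac finite_subset[of _ "L \<times> L"]) auto
  have OA: "?O \<subseteq> A" unfolding ordered_dangerous_def A_def by auto
  \<comment> \<open>Here \<open>1322 = 2 * 661\<close> and \<open>81 = 2 * 40 + 1\<close>.\<close>
  have O: "real (card ?O) * 81 \<le> 1322 * ?N"
  proof -
    have "card ?O * 81 \<le> card ?O * (2 * n + 1)" using n by (intro mult_left_mono) auto
    also have "\<dots> \<le> 2 * q * card L" using deg by (rule card_ordered_dangerous_le)
    also have "\<dots> \<le> 1322 * card L" using q by (intro mult_right_mono) auto
    finally show ?thesis using of_nat_mono[of "card ?O * 81" "1322 * card L", where 'a = real] by simp
  qed
  have ln0: "ln (real n) \<ge> 0" using n by simp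
  have "real (card (A - ?O)) * (484 * (ln (real n))\<^sup>2) = (\<Sum>x\<in>A-?O. (22 * ln (real n))\<^sup>2)"
    by (simp add: power_mult_distrib)
  also have "\<dots> \<le> (\<Sum>x\<in>A-?O. (?d (fst x) (snd x))\<^sup>2)"
  proof (intro sum_mono power_mono)
    fix x assume "x \<in> A - ?O"
    then show "22 * ln (real n) \<le> ?d (fst x) (snd x)" unfolding A_def ordered_dangerous_def by auto
  qed (use ln0 in simp)
  also have "\<dots> \<le> (\<Sum>x\<in>L\<times>L. (?d (fst x) (snd x))\<^sup>2)"
    using finite_lines by (intro sum_mono2) (auto simp: A_def)
  also have "\<dots> = (\<Sum>l\<in>L. \<Sum>l'\<in>L. (?d l l')\<^sup>2)" by (simp add: sum.cartesian_product split_beta)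
  also have "\<dots> \<le> 2 * real d * real n * ?N\<^sup>2" by (rule sum_squared_l1_dist_le[OF assms(1)])
  finally have main: "real (card (A - ?O)) * (484 * (ln (real n))\<^sup>2) \<le> 2 * real d * real n * ?N\<^sup>2" .
  have "real (card (A - ?O)) = real (card A) - real (card ?O)"
    using finA OA finite_ordered_dangerous card_mono[OF finA OA] by (simp add: card_Diff_subset of_nat_diff)
  moreover have "1641 * ?N \<le> ?N * ?N" using N by (intro mult_right_mono) auto
  \<comment> \<open>The diagonal and the dangerous pairs make up less than \<open>18 * ?N\<close> of
    the \<open>?N^2\<close> pairs, and \<open>?N\<close> is at least 1641.\<close>
  ultimately have "98 / 100 * ?N\<^sup>2 \<le> real (card (A - ?O))"
    using O N unfolding cardA power2_eq_square by linarith
  then have "98 / 100 * ?N\<^sup>2 * (484 * (ln (real n))\<^sup>2) \<le> real (card (A - ?O)) * (484 * (ln (real n))\<^sup>2)"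
    by (intro mult_right_mono) auto
  with main have "?N\<^sup>2 * (98 / 100 * 484 * (ln (real n))\<^sup>2) \<le> ?N\<^sup>2 * (2 * real d * real n)"
    by (simp add: mult_ac)
  then have "98 / 100 * 484 * (ln (real n))\<^sup>2 \<le> 2 * real d * real n"
    using N by (subst (asm) mult_le_cancel_left_pos) auto
  moreover have "474 * (ln (real n))\<^sup>2 \<le> 98 / 100 * 484 * (ln (real n))\<^sup>2" by (intro mult_right_mono) auto
  ultimately show ?thesis by linarith
qed

end

section \<open>Numerical estimates and the main result\<close>

lemma choose_two_le:
  assumes "n \<le> k"
  shows "(n\<^sup>2 + n + 1) choose 2 \<le> (k\<^sup>2 + k + 1) * (k\<^sup>2 + k) div 2"
proof -
  have "n\<^sup>2 \<le> k\<^sup>2" using assms by (intro power_mono) auto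
  then have "(n\<^sup>2 + n + 1) * (n\<^sup>2 + n) \<le> (k\<^sup>2 + k + 1) * (k\<^sup>2 + k)"
    using \<open>n\<^sup>2 \<le> k\<^sup>2\<close> assms by (intro mult_mono add_mono) auto
  then show ?thesis unfolding choose_two by (intro div_le_mono) simp
qed

text \<open>The inequality fails for \<open>n = 6\<close>. In the induction step, Bernoulli's
  inequality bounds the growth of the power, leaving a polynomial inequality.\<close>

lemma choose_two_times_fact_less:
  assumes "n \<ge> 7"
  shows "((n\<^sup>2 + n + 1) choose 2) * fact n < (n + 3) ^ n"
proof -
  have "real ((n\<^sup>2 + n + 1) * (n\<^sup>2 + n)) * fact n < 2 * (real n + 3) ^ n"
    using assms
  proof (induction n rule: nat_induct_at_least)
    case base
    show ?case by (simp add: fact_numeral)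
  next
    case (Suc n)
    define x where "x = real n"
    obtain k where k: "n = 7 + k" using Suc(1) le_Suc_ex by blast
    have x: "x > 0" using Suc(1) by (simp add: x_def)
    have "1 + real n * (1 / (x + 3)) \<le> (1 + 1 / (x + 3)) ^ n"
      using x by (intro Bernoulli_inequality) (simp add: field_simps)
    then have "(2 * x + 3) / (x + 3) \<le> ((x + 4) / (x + 3)) ^ n"
      using x by (simp add: x_def field_simps)
    then have pow: "(2 * x + 3) * (x + 3) ^ n \<le> (x + 3) * (x + 4) ^ n"
      using x by (simp add: power_divide field_simps)
    \<comment> \<open>With \<open>n = 7 + k\<close> the difference of the two sides is a polynomial
      in \<open>k\<close> with nonnegative coefficients.\<close>
    have poly: "(x\<^sup>2 + 3 * x + 3) * (x + 2) * (x + 1) * (x + 3) \<le> (x + 4) * (2 * x + 3) * (x\<^sup>2 + x + 1) * x"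
      unfolding x_def k by (simp add: power2_eq_square algebra_simps)
    have step: "real (((Suc n)\<^sup>2 + Suc n + 1) * ((Suc n)\<^sup>2 + Suc n)) * fact (Suc n)
        = (x\<^sup>2 + 3 * x + 3) * (x + 2) * (x + 1) * (x + 1) * fact n"
      unfolding x_def by (simp add: power2_eq_square algebra_simps)
    have IH: "(x\<^sup>2 + x + 1) * x * (x + 1) * fact n < 2 * (x + 3) ^ n"
      using Suc.IH unfolding x_def by (simp add: power2_eq_square algebra_simps)
    have "(x + 3) * ((x\<^sup>2 + 3 * x + 3) * (x + 2) * (x + 1) * (x + 1) * fact n)
        = ((x\<^sup>2 + 3 * x + 3) * (x + 2) * (x + 1) * (x + 3)) * ((x + 1) * fact n)"
      by (simp only: mult_ac)
    also have "\<dots> \<le> ((x + 4) * (2 * x + 3) * (x\<^sup>2 + x + 1) * x) * ((x + 1) * fact n)"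
      using poly x by (intro mult_right_mono) auto
    also have "\<dots> = (x + 4) * (2 * x + 3) * ((x\<^sup>2 + x + 1) * x * (x + 1) * fact n)" by (simp only: mult_ac)
    also have "\<dots> < (x + 4) * (2 * x + 3) * (2 * (x + 3) ^ n)"
      using IH x by (intro mult_strict_left_mono) auto
    also have "\<dots> = 2 * (x + 4) * ((2 * x + 3) * (x + 3) ^ n)" by (simp only: mult_ac)
    also have "\<dots> \<le> 2 * (x + 4) * ((x + 3) * (x + 4) ^ n)"
      using pow x by (intro mult_left_mono) auto
    also have "\<dots> = (x + 3) * (2 * (x + 4) ^ Suc n)" by simp
    finally have "(x\<^sup>2 + 3 * x + 3) * (x + 2) * (x + 1) * (x + 1) * fact n < 2 * (x + 4) ^ Suc n"
      using x by (subst (asm) mult_less_cancel_left_pos) auto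
    moreover have "real (Suc n) + 3 = x + 4" by (simp add: x_def)
    ultimately show ?case unfolding step by (simp only:)
  qed
  then have "real ((n\<^sup>2 + n + 1) * (n\<^sup>2 + n) * fact n) < real (2 * (n + 3) ^ n)" by simp
  then have "(n\<^sup>2 + n + 1) * (n\<^sup>2 + n) * fact n < 2 * (n + 3) ^ n" by (simp only: of_nat_less_iff)
  moreover have "2 * ((n\<^sup>2 + n + 1) choose 2) = (n\<^sup>2 + n + 1) * (n\<^sup>2 + n)"
    unfolding choose_two by (simp add: dvd_mult_div_cancel)
  ultimately have "2 * (((n\<^sup>2 + n + 1) choose 2) * fact n) < 2 * (n + 3) ^ n"
    by (simp only: mult.assoc[symmetric])
  then show ?thesis by simp
qed

text \<open>On each range \<open>q\<close> is determined by the lower end and the inequality is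
  checked at the upper end.\<close>

lemma ex_multinomial_bound_13:
  assumes "40 \<le> n" "n < 140"
  shows "\<exists>q. q * 13 \<le> n \<and> ((n\<^sup>2 + n + 1) choose 2)\<^sup>2 < (4 * q + 1) ^ (13 - 1)"
proof -
  have *: "((n\<^sup>2 + n + 1) choose 2)\<^sup>2 < (4 * q + 1) ^ 12"
    if "n \<le> k" "(k\<^sup>2 + k + 1) * (k\<^sup>2 + k) div 2 < (4 * q + 1) ^ 6" for q k
  proof -
    have "(n\<^sup>2 + n + 1) choose 2 < (4 * q + 1) ^ 6" using choose_two_le[OF that(1)] that(2) by simp
    then have "((n\<^sup>2 + n + 1) choose 2)\<^sup>2 < ((4 * q + 1) ^ 6)\<^sup>2" by (intro power_strict_mono) auto
    then show ?thesis by (simp only: power_mult[symmetric]) simp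
  qed
  consider "n \<le> 51" | "52 \<le> n" "n \<le> 77" | "78 \<le> n" "n \<le> 139" using assms by linarith
  then show ?thesis
  proof cases
    case 1
    then show ?thesis using *[of 51 3] assms by (intro exI[of _ 3]) simp
  next
    case 2
    then show ?thesis using *[of 77 4] by (intro exI[of _ 4]) simp
  next
    case 3
    then show ?thesis using *[of 139 6] by (intro exI[of _ 6]) simp
  qed
qed

lemma choose_two_le_real: "real ((n\<^sup>2 + n + 1) choose 2) \<le> ((real n)\<^sup>2 + real n + 1)\<^sup>2 / 2"
proof -
  have "2 * ((n\<^sup>2 + n + 1) choose 2) = (n\<^sup>2 + n + 1) * (n\<^sup>2 + n)"
    unfolding choose_two by (simp add: dvd_mult_div_cancel)
  also have "\<dots> \<le> (n\<^sup>2 + n + 1)\<^sup>2" by (simp add: power2_eq_square)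
  finally have "real (2 * ((n\<^sup>2 + n + 1) choose 2)) \<le> real ((n\<^sup>2 + n + 1)\<^sup>2)" by (simp only: of_nat_le_iff)
  then show ?thesis by (simp only: of_nat_add of_nat_mult of_nat_power of_nat_1 of_nat_numeral)
qed

lemma ex_multinomial_bound_11:
  assumes "140 \<le> n"
  shows "\<exists>q. q * 11 \<le> n \<and> ((n\<^sup>2 + n + 1) choose 2)\<^sup>2 < (4 * q + 1) ^ (11 - 1)"
proof (intro exI conjI)
  define q where "q = n div 11"
  define x where "x = real n"
  have x: "x \<ge> 140" using assms by (simp add: x_def)
  show "n div 11 * 11 \<le> n" by simp
  have "n < q * 11 + 11" unfolding q_def by linarith
  then have "x < real q * 11 + 11" unfolding x_def by linarith
  then have q: "x / 3 \<le> real (4 * q + 1)" using x by simp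
  have "140 * x \<le> x * x" using x by (intro mult_right_mono) auto
  then have "x\<^sup>2 + x + 1 \<le> 101 / 100 * x\<^sup>2" using x unfolding power2_eq_square by linarith
  then have "(x\<^sup>2 + x + 1)\<^sup>2 \<le> (101 / 100 * x\<^sup>2)\<^sup>2" using x by (intro power_mono) auto
  also have "\<dots> = (101 / 100)\<^sup>2 * x ^ 4" by (simp only: power_mult_distrib power_mult[symmetric]) simp
  finally have "real ((n\<^sup>2 + n + 1) choose 2) \<le> (101 / 100)\<^sup>2 / 2 * x ^ 4"
    using choose_two_le_real[of n] unfolding x_def by linarith
  \<comment> \<open>The left coefficient times 243 is below 124, which is less than
    \<open>x\<close>.\<close>
  also have "\<dots> < x / 243 * x ^ 4"
    using x by (intro mult_strict_right_mono) (auto simp: power2_eq_square)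
  also have "\<dots> = (x / 3) ^ 5" by (simp add: power_divide eval_nat_numeral)
  also have "\<dots> \<le> real (4 * q + 1) ^ 5" using q x by (intro power_mono) auto
  finally have "real ((n\<^sup>2 + n + 1) choose 2) < real ((4 * q + 1) ^ 5)" by simp
  then have "(n\<^sup>2 + n + 1) choose 2 < (4 * q + 1) ^ 5" by (simp only: of_nat_less_iff)
  then have "((n\<^sup>2 + n + 1) choose 2)\<^sup>2 < ((4 * q + 1) ^ 5)\<^sup>2" by (intro power_strict_mono) auto
  then show "((n\<^sup>2 + n + 1) choose 2)\<^sup>2 < (4 * (n div 11) + 1) ^ (11 - 1)"
    unfolding q_def by (simp only: power_mult[symmetric]) simp
qed

lemma ex_multinomial_bound_10:
  assumes "1102 \<le> n"
  shows "\<exists>q. q * 10 \<le> n \<and> ((n\<^sup>2 + n + 1) choose 2)\<^sup>2 < (4 * q + 1) ^ (10 - 1)"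
proof (intro exI conjI)
  define q where "q = n div 10"
  define x where "x = real n"
  have x: "x \<ge> 1102" using assms by (simp add: x_def)
  show "n div 10 * 10 \<le> n" by simp
  have "n < q * 10 + 10" unfolding q_def by linarith
  then have "x < real q * 10 + 10" unfolding x_def by linarith
  then have q: "397 / 1000 * x \<le> real (4 * q + 1)" using x by simp
  have "1102 * x \<le> x * x" using x by (intro mult_right_mono) auto
  then have "x\<^sup>2 + x + 1 \<le> 1001 / 1000 * x\<^sup>2" using x unfolding power2_eq_square by linarith
  then have "(x\<^sup>2 + x + 1)\<^sup>2 \<le> (1001 / 1000 * x\<^sup>2)\<^sup>2" using x by (intro power_mono) auto
  also have "\<dots> = (1001 / 1000)\<^sup>2 * x ^ 4" by (simp only: power_mult_distrib power_mult[symmetric]) simp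
  finally have "real ((n\<^sup>2 + n + 1) choose 2) \<le> (1001 / 1000)\<^sup>2 / 2 * x ^ 4"
    using choose_two_le_real[of n] unfolding x_def by linarith
  then have "(real ((n\<^sup>2 + n + 1) choose 2))\<^sup>2 \<le> ((1001 / 1000)\<^sup>2 / 2 * x ^ 4)\<^sup>2"
    by (intro power_mono) auto
  also have "\<dots> = ((1001 / 1000)\<^sup>2 / 2)\<^sup>2 * x ^ 8" by (simp only: power_mult_distrib power_mult[symmetric]) simp
  also have "\<dots> < (397 / 1000) ^ 9 * x * x ^ 8"
  proof (rule mult_strict_right_mono)
    have "((1001 / 1000)\<^sup>2 / 2)\<^sup>2 < (397 / 1000) ^ 9 * (1102 :: real)" by (simp add: power_divide)
    also have "\<dots> \<le> (397 / 1000) ^ 9 * x" using x by (intro mult_left_mono) auto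
    finally show "((1001 / 1000)\<^sup>2 / 2)\<^sup>2 < (397 / 1000) ^ 9 * x" .
  qed (use x in simp)
  also have "\<dots> = (397 / 1000 * x) ^ 9" unfolding power_mult_distrib by (simp add: eval_nat_numeral)
  also have "\<dots> \<le> real (4 * q + 1) ^ 9" using q x by (intro power_mono) auto
  finally have "real (((n\<^sup>2 + n + 1) choose 2)\<^sup>2) < real ((4 * q + 1) ^ 9)" by simp
  then have "((n\<^sup>2 + n + 1) choose 2)\<^sup>2 < (4 * q + 1) ^ 9" by (simp only: of_nat_less_iff)
  then show "((n\<^sup>2 + n + 1) choose 2)\<^sup>2 < (4 * (n div 10) + 1) ^ (10 - 1)"
    unfolding q_def by simp
qed

text \<open>The factor is \<open>11 + 1\<close>: if a line has at least \<open>ln n\<close> points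
  in \<open>S\<close>, at most \<open>n + 1 - ln n \<le> 11 * ln n\<close> lie outside.\<close>

lemma ln_ge_linear_small:
  assumes "2 \<le> n" "n \<le> 39"
  shows "real n + 1 \<le> 12 * ln (real n)"
proof -
  have *: "real n + 1 \<le> 12 * ln (real n)"
    if "k \<le> n" "real n + 1 \<le> 12 * (real p / real q)" "0 < k" "0 < p" "0 < q" "(68 / 25) ^ p \<le> real k ^ q"
    for k p q
  proof -
    have "real p / real q < ln (real k)" using that by (intro ln_gt_rational) auto
    also have "\<dots> \<le> ln (real n)" using that by simp
    finally show ?thesis using that(2) by simp
  qed
  consider "n \<le> 6" | "6 \<le> n" "n \<le> 19" | "19 \<le> n" "n \<le> 34" | "34 \<le> n" using assms by linarith
  then show ?thesis
  proof cases
    case 1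
    then show ?thesis using assms by (intro *[of 2 13 20]) (simp_all add: power_divide)
  next
    case 2
    then show ?thesis by (intro *[of 6 17 10]) (simp_all add: power_divide)
  next
    case 3
    then show ?thesis by (intro *[of 19 73 25]) (simp_all add: power_divide)
  next
    case 4
    then show ?thesis using assms by (intro *[of 34 17 5]) (simp_all add: power_divide)
  qed
qed

text \<open>On the range from \<open>k\<close> to \<open>k'\<close>, the logarithm is estimated at
  the lower end and the linear term at the upper end.\<close>

lemma variance_contradiction:
  assumes "474 * (ln (real n))\<^sup>2 \<le> 2 * real d * real n" "d \<le> c"
    and "k \<le> n" "n < k'" "0 < k" "0 < p" "0 < q" "(68 / 25) ^ p \<le> real k ^ q"
    and "2 * real c * real k' \<le> 474 * (real p / real q)\<^sup>2"
  shows False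
proof -
  have "real p / real q < ln (real k)" using assms by (intro ln_gt_rational) auto
  also have "\<dots> \<le> ln (real n)" using assms by simp
  finally have less: "real p / real q < ln (real n)" .
  then have "474 * (real p / real q)\<^sup>2 \<le> 474 * (ln (real n))\<^sup>2" by (simp add: power_mono)
  moreover have "real d * real n \<le> real c * real k'" using assms by (intro mult_mono) auto
  ultimately have "474 * (real p / real q)\<^sup>2 = 474 * (ln (real n))\<^sup>2" using assms by linarith
  then have "real p / real q = ln (real n)"
    using assms by (simp add: power2_eq_iff_nonneg)
  with less show False by simp
qed

section \<open>Dangerous pairs and equality of line types\<close>

lemma sum_card_color_classes_le:
  assumes "finite A" "finite I"
  shows "(\<Sum>i\<in>I. card {p\<in>A. g p = i}) \<le> card A"
proof -
  have "(\<Sum>i\<in>I. card {p\<in>A. g p = i}) = card (\<Union>i\<in>I. {p\<in>A. g p = i})"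
    using assms by (intro card_UN_disjoint[symmetric]) auto
  also have "\<dots> \<le> card A" using assms by (intro card_mono) auto
  finally show ?thesis .
qed

context projective_plane
begin

text \<open>If two lines had equal types, their types outside \<open>S\<close> would differ by at
  most the numbers of points of \<open>S\<close> on them. The pair would be dangerous, but dangerous
  pairs are unbalanced by the counting method.\<close>

lemma legitimate_coloring_from_partial:
  assumes S: "S \<subseteq> P" and f: "f \<in> P - S \<rightarrow> {1..d}" and "d \<le> c"
    and deg: "\<And>p. p \<in> P \<Longrightarrow> card {D \<in> dangerous_pairs P L n S d f. p \<in> \<Union>D} \<le> q"
    and small: "\<And>l. l \<in> L \<Longrightarrow> real (card (l \<inter> S)) \<le> 11 * ln (real n)"
    and m: "m \<ge> 1" "\<And>l l'. l \<in> L \<Longrightarrow> l' \<in> L \<Longrightarrow> l \<noteq> l' \<Longrightarrow> m \<le> card ((l - l') \<inter> S)"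
    and \<beta>: "\<beta> > 0" "\<beta> + real q * fact m / \<beta> ^ (m - 1) \<le> real c"
  shows "\<exists>g. legitimate_coloring P L c g"
proof -
  have fc: "f \<in> P - S \<rightarrow> {1..c}" using f \<open>d \<le> c\<close> by force
  have "\<exists>g\<in>P \<rightarrow> {1..c}. (\<forall>p\<in>P - S. g p = f p) \<and>
      (\<forall>l l'. {l, l'} \<in> dangerous_pairs P L n S d f \<longrightarrow> \<not> balanced c g (l - l') (l' - l))"
    by (rule rosenfeld_plane_coloring[OF S fc dangerous_pairs_subset deg m \<beta>])
  then obtain g where g: "g \<in> P \<rightarrow> {1..c}" "\<And>p. p \<in> P - S \<Longrightarrow> g p = f p"
    "\<And>l l'. {l, l'} \<in> dangerous_pairs P L n S d f \<Longrightarrow> \<not> balanced c g (l - l') (l' - l)"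
    by blast
  have "line_type c P g l \<noteq> line_type c P g l'" if l: "l \<in> L" "l' \<in> L" "l \<noteq> l'" for l l'
  proof
    assume eq: "line_type c P g l = line_type c P g l'"
    let ?t = "line_type d (P - S) f"
    let ?s = "\<lambda>k i. card {p\<in>k\<inter>S. g p = i}"
    have tot: "card {p\<in>k\<inter>P. g p = i} = ?t k i + ?s k i" if "k \<in> L" "i \<in> {1..d}" for k i
    proof -
      have "{p\<in>k\<inter>P. g p = i} = (k \<inter> {p\<in>P-S. f p = i}) \<union> {p\<in>k\<inter>S. g p = i}"
        using g(2) S by auto
      moreover have "finite k" using finite_line that by simp
      ultimately show ?thesis unfolding line_type_outside[OF that(2)]
        by (simp add: card_Un_disjoint disjoint_iff)
    qed
    have s: "int (\<Sum>i\<in>{1..d}. ?s k i) \<le> int (card (k \<inter> S))" if "k \<in> L" for k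
      unfolding of_nat_le_iff using finite_line[OF that] by (intro sum_card_color_classes_le) auto
    have "l1_dist d (?t l) (?t l') \<le> (\<Sum>i\<in>{1..d}. int (?s l i) + int (?s l' i))"
      unfolding l1_dist_def
    proof (rule sum_mono)
      fix i assume i: "i \<in> {1..d}"
      then have "card {p\<in>l\<inter>P. g p = i} = card {p\<in>l'\<inter>P. g p = i}"
        using fun_cong[OF eq, of i] \<open>d \<le> c\<close> by (simp add: line_type_def)
      then show "\<bar>int (?t l i) - int (?t l' i)\<bar> \<le> int (?s l i) + int (?s l' i)"
        unfolding tot[OF l(1) i] tot[OF l(2) i] by linarith
    qed
    also have "\<dots> \<le> int (card (l \<inter> S)) + int (card (l' \<inter> S))"
      using s[OF l(1)] s[OF l(2)] by (simp add: sum.distrib)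
    finally have "real_of_int (l1_dist d (?t l) (?t l')) \<le> real (card (l \<inter> S)) + real (card (l' \<inter> S))"
      by linarith
    then have "real_of_int (l1_dist d (?t l) (?t l')) \<le> 22 * ln (real n)"
      using small[OF l(1)] small[OF l(2)] by linarith
    then have "{l, l'} \<in> dangerous_pairs P L n S d f" unfolding dangerous_pairs_def using l by blast
    then show False using g(3) balanced_if_line_type_eq[OF l(1,2) eq] by blast
  qed
  then show ?thesis using g(1) unfolding legitimate_coloring_def by blast
qed

text \<open>Each line has at most \<open>11 * ln n\<close> points outside \<open>S\<close>, so every
  pair of distinct lines is dangerous.\<close>

lemma l1_dist_outside_le:
  assumes l: "l \<in> L" "l' \<in> L" and large: "\<And>l. l \<in> L \<Longrightarrow> ln (real n) \<le> real (card (l \<inter> S))"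
    and n: "real n + 1 \<le> 12 * ln (real n)"
  shows "real_of_int (l1_dist d (line_type d (P - S) f l) (line_type d (P - S) f l')) \<le> 22 * ln (real n)"
proof -
  let ?t = "line_type d (P - S) f"
  have t: "real (\<Sum>i\<in>{1..d}. ?t k i) \<le> 11 * ln (real n)" if "k \<in> L" for k
  proof -
    have "(\<Sum>i\<in>{1..d}. ?t k i) = (\<Sum>i\<in>{1..d}. card {p\<in>k\<inter>(P-S). f p = i})"
      by (simp add: line_type_def)
    also have "\<dots> \<le> card (k \<inter> (P - S))"
      using finite_line[OF that] by (intro sum_card_color_classes_le) auto
    also have "k \<inter> (P - S) = k - k \<inter> S" using lines_subset[OF that] by blast
    also have "card (k - k \<inter> S) = (n + 1) - card (k \<inter> S)"
      using finite_line[OF that] card_line[OF that] by (simp add: card_Diff_subset)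
    finally have "(\<Sum>i\<in>{1..d}. ?t k i) \<le> (n + 1) - card (k \<inter> S)" .
    moreover have "card (k \<inter> S) \<le> n + 1"
      using card_mono[of k "k \<inter> S"] finite_line[OF that] card_line[OF that] by simp
    ultimately have "real (\<Sum>i\<in>{1..d}. ?t k i) \<le> real (n + 1) - real (card (k \<inter> S))" by linarith
    then show ?thesis using large[OF that] n by linarith
  qed
  have "l1_dist d (?t l) (?t l') \<le> (\<Sum>i\<in>{1..d}. int (?t l i) + int (?t l' i))"
    unfolding l1_dist_def by (intro sum_mono) linarith
  also have "\<dots> = int (\<Sum>i\<in>{1..d}. ?t l i) + int (\<Sum>i\<in>{1..d}. ?t l' i)" by (simp add: sum.distrib)
  finally show ?thesis using t[OF l(1)] t[OF l(2)] by linarith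
qed

end

section \<open>Case distinction by the order of the plane\<close>

theorem mainTheorem2:
  fixes P S :: "'p set" and L :: "'p set set" and n a b d :: nat
  assumes "projective_plane P L n"
    and "a > 0" and "b > 0"
    and "S \<subseteq> P"
    and "\<And>l. l \<in> L \<Longrightarrow> ln (real n) \<le> real (card (l \<inter> S)) \<and> real (card (l \<inter> S)) \<le> 11 * ln (real n)"
    and "is_number_of_colors_needed P L n S a b d"
  shows "\<exists>g. legitimate_coloring P L (max d (nat \<lceil>INF m\<in>{2..}. color_bound a b m\<rceil>)) g"
proof -
  interpret projective_plane P L n by (rule assms(1))
  note ab = assms(2,3)
  let ?q = "a * b"
  define c where "c = max d (nat \<lceil>INF m\<in>{2..}. color_bound a b m\<rceil>)"
  obtain m where m: "m \<ge> 2" "color_bound a b m = (INF k\<in>{2..}. color_bound a b k)"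
    and min: "\<forall>k\<ge>2. color_bound a b m \<le> color_bound a b k"
    using color_bound_attains_minimum[OF ab] by blast
  have dc: "d \<le> c" by (simp add: c_def)
  have bound: "color_bound a b m \<le> real c"
    unfolding m(2) c_def by (rule order_trans[OF real_nat_ceiling_ge]) simp
  \<comment> \<open>The bound exceeds \<open>m + 1\<close> strictly and \<open>c\<close> is an
    integer.\<close>
  have m_lt: "c \<ge> m + 2" if "m \<ge> 3"
  proof -
    have "real m + 1 < color_bound a b m" using that ab min by (intro color_bound_minimizer_gt) auto
    then show ?thesis using bound by linarith
  qed
  have power_le: "fact m * ?q * (m - 1) * m ^ m \<le> (k * (m - 1)) ^ m" if "c \<le> k" for k
    using that bound by (intro color_bound_le_imp m(1) ab) linarith
  have q_le: "?q \<le> 661" if "c \<le> 12"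
    using that bound by (intro color_bound_minimizer_le_12[OF m(1) ab min]) linarith
  obtain \<beta> where \<beta>: "\<beta> > 0" "\<beta> + real ?q * fact m / \<beta> ^ (m - 1) \<le> real c"
    using color_bound_eq_root(1,4)[OF m(1) ab] bound by metis
  obtain f where f: "f \<in> P - S \<rightarrow> {1..d}"
    and deg: "\<And>p. p \<in> P \<Longrightarrow> card {D \<in> dangerous_pairs P L n S d f. p \<in> \<Union>D} \<le> ?q"
    using assms(6) unfolding is_number_of_colors_needed_def good_partial_coloring_def by blast
  note large = conjunct1[OF assms(5)] and small = conjunct2[OF assms(5)]
  have l1_le: "real_of_int (l1_dist d (line_type d (P - S) f l) (line_type d (P - S) f l')) \<le> 22 * ln (real n)"
    if "n \<le> 39" "l \<in> L" "l' \<in> L" for l l'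
    by (rule l1_dist_outside_le[OF that(2,3) large ln_ge_linear_small[OF order_ge_2 that(1)]])
  have variance: "474 * (ln (real n))\<^sup>2 \<le> 2 * real d * real n" if "40 \<le> n" "c \<le> 12"
    by (rule variance_bound[OF assms(4) that(1) q_le[OF that(2)] deg])
  have mono: "\<exists>g. legitimate_coloring P L c g" if "\<exists>g. legitimate_coloring P L k g" "k \<le> c" for k
    using that legitimate_coloring_mono by blast
  have multinomial: "\<exists>g. legitimate_coloring P L c g"
    if "\<exists>q. q * k \<le> n \<and> ((n\<^sup>2 + n + 1) choose 2)\<^sup>2 < (4 * q + 1) ^ (k - 1)" "5 \<le> k" "k \<le> c" for k
    using that legitimate_coloring_if_multinomial_less[of k] by (intro mono[of k]) auto
  have "n \<ge> 2" by (rule order_ge_2)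
  \<comment> \<open>Up to 39 all pairs are dangerous. The three ranges above use union bounds with
    13, 11 and 10 colors, respectively, the last one only for \<open>m > 7\<close>.\<close>
  then consider "n \<le> 39" "m \<le> n" | "n \<le> 39" "n < m" | "40 \<le> n" "n < 140" | "140 \<le> n" "n < 1102" | "1102 \<le> n"
    by linarith
  then have "\<exists>g. legitimate_coloring P L c g"
  proof cases
    case 1
    have all: "{l, l'} \<in> dangerous_pairs P L n S d f" if "l \<in> L" "l' \<in> L" "l \<noteq> l'" for l l'
      unfolding dangerous_pairs_def
      using that l1_le[OF 1(1) that(1,2)] by blast
    \<comment> \<open>Recoloring the whole plane makes all \<open>n\<close> points of
      \<open>l - l'\<close> available.\<close>
    have size: "m \<le> card ((l - l') \<inter> P)" if "l \<in> L" "l' \<in> L" "l \<noteq> l'" for l l'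
    proof -
      have "(l - l') \<inter> P = l - l'" using lines_subset that by blast
      then show ?thesis using card_Diff_lines[OF that] 1(2) by simp
    qed
    have fP: "f \<in> P - P \<rightarrow> {1..c}" and m1: "m \<ge> 1" using m by auto
    have "\<exists>g\<in>P \<rightarrow> {1..c}. (\<forall>p\<in>P - P. g p = f p) \<and>
        (\<forall>l l'. {l, l'} \<in> dangerous_pairs P L n S d f \<longrightarrow> \<not> balanced c g (l - l') (l' - l))"
      by (rule rosenfeld_plane_coloring[OF order_refl fP dangerous_pairs_subset deg m1 size \<beta>])
    then obtain g where "g \<in> P \<rightarrow> {1..c}"
      "\<And>l l'. {l, l'} \<in> dangerous_pairs P L n S d f \<Longrightarrow> \<not> balanced c g (l - l') (l' - l)"
      by blast
    then show ?thesis using all by (intro exI[of _ g] legitimate_if_unbalanced) auto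
  next
    case 2
    have cm: "c \<ge> m + 2" using 2 \<open>n \<ge> 2\<close> m_lt by linarith
    have "((n\<^sup>2 + n + 1) choose 2) * fact n < c ^ n"
    proof (cases "n \<ge> 7")
      case True
      have "((n\<^sup>2 + n + 1) choose 2) * fact n < (n + 3) ^ n" by (rule choose_two_times_fact_less[OF True])
      also have "\<dots> \<le> c ^ n" using cm 2 by (intro power_mono) auto
      finally show ?thesis .
    next
      case False
      \<comment> \<open>For these orders \<open>n + 3\<close> colors are too few for the union
        bound. As all pairs are dangerous, counting them bounds \<open>a * b\<close> from below,
        which forces more colors.\<close>
      have q: "(n\<^sup>2 + n) * (2 * n + 1) \<le> 2 * ?q"
      proof -
        have "ordered_dangerous S d f = L \<times> L - (\<lambda>l. (l, l)) ` L"
          unfolding ordered_dangerous_def using l1_le[OF 2(1)] by blast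
        moreover have "card ((\<lambda>l. (l, l)) ` L) = card L" by (intro card_image inj_onI) simp
        ultimately have "card (ordered_dangerous S d f) = card L * card L - card L"
          using finite_lines by (simp add: card_Diff_subset card_cartesian_product image_subset_iff)
        also have "\<dots> = card L * (n\<^sup>2 + n)" by (simp add: card_lines)
        finally have O: "card (ordered_dangerous S d f) = card L * (n\<^sup>2 + n)" .
        have "card (ordered_dangerous S d f) * (2 * n + 1) \<le> 2 * ?q * card L"
          by (rule card_ordered_dangerous_le[OF deg])
        then have "card L * ((n\<^sup>2 + n) * (2 * n + 1)) \<le> card L * (2 * ?q)"
          unfolding O by (simp only: mult_ac)
        moreover have "card L > 0" by (simp add: card_lines)
        ultimately show ?thesis by (simp only: mult_le_cancel1)
      qed
      have less: "((n\<^sup>2 + n + 1) choose 2) * fact n < c ^ n"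
        if "k < c" "((n\<^sup>2 + n + 1) choose 2) * fact n < (k + 1) ^ n" for k
      proof -
        have "(k + 1) ^ n \<le> c ^ n" using that(1) by (intro power_mono) auto
        with that(2) show ?thesis by (rule less_le_trans)
      qed
      consider "n = 2" | "n = 3" | "n = 4" | "n = 5" | "n = 6" using False \<open>n \<ge> 2\<close> by linarith
      then show ?thesis
      proof cases
        case n: 1
        \<comment> \<open>Otherwise \<open>n < m \<le> c - 2\<close> leaves only two values of
          \<open>m\<close>, and for both \<open>power_le\<close> contradicts the lower bound on
          \<open>a * b\<close>. The other orders are treated alike.\<close>
        have "6 < c"
        proof (rule ccontr)
          assume "\<not> 6 < c"
          then have "c \<le> 6" "m = 3 \<or> m = 4" using cm 2 n by auto
          then show False using power_le[of 6] q n by (auto simp: fact_numeral)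
        qed
        then show ?thesis by (rule less) (simp add: n choose_two fact_numeral)
      next
        case n: 2
        have "7 < c"
        proof (rule ccontr)
          assume "\<not> 7 < c"
          then have "c \<le> 7" "m = 4 \<or> m = 5" using cm 2 n by auto
          then show False using power_le[of 7] q n by (auto simp: fact_numeral)
        qed
        then show ?thesis by (rule less) (simp add: n choose_two fact_numeral)
      next
        case n: 3
        have "8 < c"
        proof (rule ccontr)
          assume "\<not> 8 < c"
          then have "c \<le> 8" "m = 5 \<or> m = 6" using cm 2 n by auto
          then show False using power_le[of 8] q n by (auto simp: fact_numeral)
        qed
        then show ?thesis by (rule less) (simp add: n choose_two fact_numeral)
      next
        case n: 4
        have "8 < c"
        proof (rule ccontr)
          assume "\<not> 8 < c"
          then have "c \<le> 8" "m = 6" using cm 2 n by auto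
          then show False using power_le[of 8] q n by (auto simp: fact_numeral)
        qed
        then show ?thesis by (rule less) (simp add: n choose_two fact_numeral)
      next
        case n: 5
        have "9 < c"
        proof (rule ccontr)
          assume "\<not> 9 < c"
          then have "c \<le> 9" "m = 7" using cm 2 n by auto
          then show False using power_le[of 9] q n by (auto simp: fact_numeral)
        qed
        then show ?thesis by (rule less) (simp add: n choose_two fact_numeral)
      qed
    qed
    then show ?thesis by (rule legitimate_coloring_if_fact_less)
  next
    case 3
    have "c \<ge> 13"
    proof (rule ccontr)
      assume "\<not> c \<ge> 13"
      then have c: "c \<le> 12" by simp
      have "474 * (ln (real n))\<^sup>2 \<le> 2 * real d * real n"
        using 3(1) c by (rule variance)
      then show False
        using dc c 3 by (intro variance_contradiction[of n d 12 40 140 7 2]) (auto simp: power_divide)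
    qed
    then show ?thesis using 3 by (intro multinomial[of 13] ex_multinomial_bound_13) auto
  next
    case 4
    have "c \<ge> 11"
    proof (rule ccontr)
      assume "\<not> c \<ge> 11"
      \<comment> \<open>The first bound gives the variance estimate, through
        \<open>a * b \<le> 661\<close>; the second one is contradicted by it.\<close>
      then have c: "c \<le> 12" "d \<le> 10" using dc by auto
      have var: "474 * (ln (real n))\<^sup>2 \<le> 2 * real d * real n"
        using variance[OF _ c(1)] 4 by linarith
      \<comment> \<open>The ranges are short enough for the logarithm at the lower end to outweigh
        the upper end.\<close>
      consider "n < 400" | "400 \<le> n" "n < 800" | "800 \<le> n" "n < 1000" | "1000 \<le> n" using 4 by linarith
      then show False
      proof cases
        case 1
        show False using 4 1 by (intro variance_contradiction[OF var c(2), of 140 400 9 2]) (auto simp: power_divide)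
      next
        case 2
        show False using 2 by (intro variance_contradiction[OF var c(2), of 400 800 59 10]) (auto simp: power_divide)
      next
        case 3
        show False using 3 by (intro variance_contradiction[OF var c(2), of 800 1000 66 10]) (auto simp: power_divide)
      next
        case 4
        show False using 4 \<open>n < 1102\<close> by (intro variance_contradiction[OF var c(2), of 1000 1102 69 10]) (auto simp: power_divide)
      qed
    qed
    then show ?thesis using 4 by (intro multinomial[of 11] ex_multinomial_bound_11) auto
  next
    case 5
    show ?thesis
    proof (cases "m \<le> 7")
      case True
      have size: "m \<le> card ((l - l') \<inter> S)" if l: "l \<in> L" "l' \<in> L" "l \<noteq> l'" for l l'
      proof -
        \<comment> \<open>1102 is the least integer above \<open>(68 / 25) ^ 7\<close>. So each line
          has at least 8 points of \<open>S\<close>, and 7 remain after removing the common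
          point.\<close>
        have "real 7 / real 1 < ln (real 1102)" by (intro ln_gt_rational) (simp_all add: power_divide)
        also have "\<dots> \<le> ln (real n)" using 5 by simp
        also have "\<dots> \<le> real (card (l \<inter> S))" by (rule large[OF l(1)])
        finally have "8 \<le> card (l \<inter> S)" by simp
        moreover have "(l - l') \<inter> S = l \<inter> S - l \<inter> l'" by blast
        moreover have "card (l \<inter> S) - card (l \<inter> l') \<le> card (l \<inter> S - l \<inter> l')"
          using finite_line[OF l(1)] by (intro diff_card_le_card_Diff) auto
        ultimately show ?thesis using True card_inter_lines[OF l] by simp
      qed
      have m1: "m \<ge> 1" using m by simp
      show ?thesis
        by (rule legitimate_coloring_from_partial[OF assms(4) f dc deg small m1 size \<beta>])
    next
      case False
      then have "c \<ge> 10" using m_lt by linarith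
      then show ?thesis using 5 by (intro multinomial[of 10] ex_multinomial_bound_10) auto
    qed
  qed
  then show ?thesis unfolding c_def .
qed

end
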